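(* Let $U$ be any ultrafilter on a complete Boolean algebra $\mathbb{B}$. The Boolean ultrapower $j_U:V\to\check V_U$ is isomorphic to the direct limit $\mathrm{dir\,lim}\langle V^A/U_A \mid j_{U_A},\pi_{A,B}\rangle$ of the induced commutative system of power set ultrapowers $j_{U_A}:V\to V^A/U_A$, indexed by the maximal antichains $A$ in $\mathbb{B}$ ordered by refinement.
   Context: Boolean ultrapower. $\mathbb{B}$-names (elements of $V^{\mathbb{B}}$) are defined recursively: $\tau$ is a $\mathbb{B}$-name if $\tau$ is a set of pairs $\langle\sigma,b\rangle$ with $\sigma$ a $\mathbb{B}$-name and $b\in\mathbb{B}$. Boolean values: $[\![\tau\in\sigma]\!]=\bigvee_{\langle\eta,b\rangle\in\sigma}[\![\tau=\eta]\!]\wedge b$, $[\![\tau=\sigma]\!]=[\![\tau\subseteq\sigma]\!]\wedge[\![\sigma\subseteq\tau]\!]$, $[\![\tau\subseteq\sigma]\!]=\bigwedge_{\eta\in\mathrm{dom}(\tau)}(\neg[\![\eta\in\tau]\!]\vee[\![\eta\in\sigma]\!])$. For $x\in V$, $\check x=\{\langle\check y,1\rangle : y\in x\}$; $[\![\tau\in\check V]\!]=\bigvee_{x\in V}[\![\tau=\check x]\!]$. Let $\tau=_U\sigma$ iff $[\![\tau=\sigma]\!]\in U$, $\tau\in_U\sigma$ iff $[\![\tau\in\sigma]\!]\in U$; $[\tau]_U$ is the $=_U$-class of $\tau$ (restricted to members of minimal rank). $\check V_U=\{[\tau]_U : [\![\tau\in\check V]\!]\in U\}$ under $\in_U$,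 and $j_U(x)=[\check x]_U$. The system. For a maximal antichain $A\subseteq\mathbb{B}$, $U_A$ is the ultrafilter on the power set $P(A)$ given by $X\in U_A$ iff $X\subseteq A$ and $\bigvee X\in U$; $V^A/U_A$ is the classical ultrapower of $V$ (using functions $f:A\to V$ in $V$), with canonical elementary embedding $j_{U_A}:V\to V^A/U_A$. A maximal antichain $B$ refines $A$ if every $b\in B$ is below some (unique) $a\in A$; in this case, for $f:A\to V$ let $f\downarrow B:B\to V$ be $(f\downarrow B)(b)=f(a)$ for $b\leq a$, and let $\pi_{A,B}:V^A/U_A\to V^B/U_B$ be the (well-defined, elementary) map $[f]_{U_A}\mapsto[f\downarrow B]_{U_B}$; one has $\pi_{A,B}\circ j_{U_A}=j_{U_B}$. Any two maximal antichains have a common refinement, so this is a directed commutative system; its direct limit consists of threads, obtained by identifying each $x\in V^A/U_A$ with all its images $\pi_{A,B}(x)$, and the associated embedding of $V$ sends $x$ to the thread of $j_{U_A}(x)$ (for any $A$). "Isomorphic" means there is an $\in$-isomorphism of $\check V_U$ with the direct limit commuting with the embeddings of $V$. *)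

theory Defs
  imports "HOL-Library.Multiset" "HOL-Library.FuncSet"
begin

unbundle lattice_syntax

section \<open>The set-theoretic universe\<close>

text \<open>
  The universe \<open>V\<close> is a type \<open>'v\<close> whose elements are the sets and whose HOL-level sets and functions
  are the classes and class functions; \<open>elts x\<close> is the class of members of \<open>x\<close>.  The axioms are
  those of ZFC, with separation, replacement and foundation stated for classes.  The axiom of choice
  is inherited from HOL: by separation and power set, a HOL choice function restricted to a set
  is again a set.
\<close>

class zfc_universe =
  fixes elts :: "'a \<Rightarrow> 'a set"
  assumes extensionality: "elts x = elts y \<Longrightarrow> x = y"
    and foundation: "wf {(x, y). x \<in> elts y}"
    and pairing: "\<exists>z. elts z = {x, y}"
    and union: "\<exists>z. elts z = (\<Union>y\<in>elts x. elts y)"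
    and power_set: "\<exists>z. elts z = {y. elts y \<subseteq> elts x}"
    and infinity: "\<exists>z e. elts e = {} \<and> e \<in> elts z \<and>
                     (\<forall>x\<in>elts z. \<exists>y\<in>elts z. elts y = insert x (elts x))"
    and separation: "\<exists>z. elts z = {y \<in> elts x. P y}"
    and replacement: "\<exists>z. elts z = f ` elts x"

text \<open>The set with a given extension; only meaningful for classes that are sets.\<close>

definition vset :: "'v::zfc_universe set \<Rightarrow> 'v" where
  "vset X = (THE x. elts x = X)"

text \<open>Kuratowski pairs.\<close>

definition vpair :: "'v::zfc_universe \<Rightarrow> 'v \<Rightarrow> 'v" where
  "vpair x y = vset {vset {x}, vset {x, y}}"

lemma elts_vset: "\<exists>z. elts z = X \<Longrightarrow> elts (vset X) = X"
  unfolding vset_def by (rule theI') (metis extensionality)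

lemma elts_vpair: "elts (vpair x y) = {vset {x}, vset {x, y}}"
  unfolding vpair_def by (intro elts_vset pairing)

lemma elts_vset_pair: "elts (vset {x, y}) = {x, y}"
  by (intro elts_vset pairing)

lemma elts_vset_single: "elts (vset {x}) = {x}"
  using elts_vset_pair[of x x] by simp

definition elt_rel :: "('v::zfc_universe \<times> 'v) set" where
  "elt_rel = {(x, y). x \<in> elts y}"

lemma wf_elt_rel: "wf elt_rel"
  unfolding elt_rel_def by (rule foundation)

text \<open>The von Neumann rank, \<open>rank x = \<Union>{rank y + 1 | y \<in> x}\<close>.\<close>

function rank :: "'v::zfc_universe \<Rightarrow> 'v" where
  "rank x = vset (\<Union>y\<in>elts x. insert (rank y) (elts (rank y)))"
  by auto
termination
  by (relation elt_rel) (rule wf_elt_rel, simp_all add: elt_rel_def)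

declare rank.simps [simp del]


section \<open>Complete Boolean algebras\<close>

text \<open>
  A complete Boolean algebra is a type \<open>'b\<close> of sort \<open>{boolean_algebra, complete_lattice}\<close>.  The
  library class \<open>complete_boolean_algebra\<close> must not be used here: it requires complete
  distributivity, which makes the algebra atomic.

  That the algebra is a set of the universe is expressed by an injection \<open>\<iota> :: 'b \<Rightarrow> 'v\<close> whose
  range is a set, so that \<open>\<iota> b\<close> is the element \<open>b\<close> regarded as an element of \<open>V\<close>.  All subsets of
  \<open>'b\<close> and all functions from such subsets to \<open>'v\<close> then are sets of \<open>V\<close> by separation and
  replacement.
\<close>

definition embeds_as_set :: "('b \<Rightarrow> 'v::zfc_universe) \<Rightarrow> bool" where
  "embeds_as_set \<iota> \<longleftrightarrow> inj \<iota> \<and> (\<exists>B. elts B = range \<iota>)"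

definition ultrafilter :: "'b::boolean_algebra set \<Rightarrow> bool" where
  "ultrafilter U \<longleftrightarrow>
     \<top> \<in> U \<and> \<bottom> \<notin> U \<and>
     (\<forall>a b. a \<in> U \<longrightarrow> a \<le> b \<longrightarrow> b \<in> U) \<and>
     (\<forall>a b. a \<in> U \<longrightarrow> b \<in> U \<longrightarrow> a \<sqinter> b \<in> U) \<and>
     (\<forall>a. a \<in> U \<or> - a \<in> U)"

text \<open>Antichains in the sense of forcing: pairwise incompatible sets of nonzero elements.\<close>

definition antichain :: "'b::boolean_algebra set \<Rightarrow> bool" where
  "antichain A \<longleftrightarrow> \<bottom> \<notin> A \<and> (\<forall>a\<in>A. \<forall>b\<in>A. a \<noteq> b \<longrightarrow> a \<sqinter> b = \<bottom>)"

definition maximal_antichain :: "'b::boolean_algebra set \<Rightarrow> bool" where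
  "maximal_antichain A \<longleftrightarrow> antichain A \<and> (\<forall>A'. antichain A' \<longrightarrow> A \<subseteq> A' \<longrightarrow> A' = A)"

definition refines :: "'b::boolean_algebra set \<Rightarrow> 'b set \<Rightarrow> bool" where
  "refines B A \<longleftrightarrow> (\<forall>b\<in>B. \<exists>a\<in>A. b \<le> a)"


section \<open>Names and Boolean values\<close>

text \<open>The class \<open>V\<^sup>B\<close> of names.\<close>

inductive bname :: "('b \<Rightarrow> 'v::zfc_universe) \<Rightarrow> 'v \<Rightarrow> bool" for \<iota> where
  "(\<And>p. p \<in> elts \<tau> \<Longrightarrow> \<exists>\<sigma> b. p = vpair \<sigma> (\<iota> b) \<and> bname \<iota> \<sigma>) \<Longrightarrow> bname \<iota> \<tau>"

definition entries :: "('b \<Rightarrow> 'v::zfc_universe) \<Rightarrow> 'v \<Rightarrow> ('v \<times> 'b) set" where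
  "entries \<iota> \<tau> = {(\<sigma>, b). vpair \<sigma> (\<iota> b) \<in> elts \<tau>}"

definition ndom :: "('b \<Rightarrow> 'v::zfc_universe) \<Rightarrow> 'v \<Rightarrow> 'v set" where
  "ndom \<iota> \<tau> = fst ` entries \<iota> \<tau>"

lemma ndom_below: "\<eta> \<in> ndom \<iota> \<tau> \<Longrightarrow> (\<eta>, \<tau>) \<in> elt_rel\<^sup>+"
proof -
  assume "\<eta> \<in> ndom \<iota> \<tau>"
  then obtain b where "vpair \<eta> (\<iota> b) \<in> elts \<tau>"
    by (auto simp: ndom_def entries_def)
  then have "(vpair \<eta> (\<iota> b), \<tau>) \<in> elt_rel"
    by (simp add: elt_rel_def)
  moreover have "(\<eta>, vset {\<eta>}) \<in> elt_rel" "(vset {\<eta>}, vpair \<eta> (\<iota> b)) \<in> elt_rel"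
    by (simp_all add: elt_rel_def elts_vset_single elts_vpair)
  ultimately show ?thesis
    by (blast intro: trancl_into_trancl)
qed

lemma entries_below: "(\<eta>, b) \<in> entries \<iota> \<tau> \<Longrightarrow> (\<eta>, \<tau>) \<in> elt_rel\<^sup>+"
  by (rule ndom_below[of _ \<iota>]) (force simp: ndom_def)

lemma mult_descent:
  shows "(\<eta>, \<sigma>) \<in> r \<Longrightarrow> ({#\<tau>, \<tau>, \<eta>, \<eta>#}, {#\<tau>, \<tau>, \<sigma>#}) \<in> mult r"
    and "(\<eta>, \<tau>) \<in> r \<Longrightarrow> ({#\<eta>, \<eta>, \<tau>#}, {#\<tau>, \<tau>, \<sigma>#}) \<in> mult r"
    and "(\<eta>, \<tau>) \<in> r \<Longrightarrow> ({#\<eta>, \<eta>, \<sigma>#}, {#\<tau>, \<tau>, \<sigma>#}) \<in> mult r"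
    and "({#\<tau>, \<tau>, \<sigma>#}, {#\<tau>, \<tau>, \<sigma>, \<sigma>#}) \<in> mult r"
    and "({#\<sigma>, \<sigma>, \<tau>#}, {#\<tau>, \<tau>, \<sigma>, \<sigma>#}) \<in> mult r"
  using one_step_implies_mult[of "{#\<sigma>#}" "{#\<eta>, \<eta>#}" r "{#\<tau>, \<tau>#}"]
    one_step_implies_mult[of "{#\<tau>, \<sigma>#}" "{#\<eta>, \<eta>#}" r "{#\<tau>#}"]
    one_step_implies_mult[of "{#\<tau>, \<tau>#}" "{#\<eta>, \<eta>#}" r "{#\<sigma>#}"]
    one_step_implies_mult[of "{#\<sigma>#}" "{#}" r "{#\<tau>, \<tau>, \<sigma>#}"]
    one_step_implies_mult[of "{#\<tau>#}" "{#}" r "{#\<sigma>, \<sigma>, \<tau>#}"]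
  by (simp_all add: add_mset_commute)

lemmas [fundef_cong] = SUP_cong INF_cong

function bval_mem bval_eq bval_sub ::
  "('b::{boolean_algebra, complete_lattice} \<Rightarrow> 'v::zfc_universe) \<Rightarrow> 'v \<Rightarrow> 'v \<Rightarrow> 'b" where
  "bval_mem \<iota> \<tau> \<sigma> = (\<Squnion>(\<eta>, b)\<in>entries \<iota> \<sigma>. bval_eq \<iota> \<tau> \<eta> \<sqinter> b)"
| "bval_eq \<iota> \<tau> \<sigma> = bval_sub \<iota> \<tau> \<sigma> \<sqinter> bval_sub \<iota> \<sigma> \<tau>"
| "bval_sub \<iota> \<tau> \<sigma> = (\<Sqinter>\<eta>\<in>ndom \<iota> \<tau>. - bval_mem \<iota> \<eta> \<tau> \<squnion> bval_mem \<iota> \<eta> \<sigma>)"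
  by pat_completeness auto
termination
  by (relation "inv_image (mult (elt_rel\<^sup>+))
      (\<lambda>s. case s of
         Inl (\<iota>, \<tau>, \<sigma>) \<Rightarrow> {#\<tau>, \<tau>, \<sigma>#}
       | Inr (Inl (\<iota>, \<tau>, \<sigma>)) \<Rightarrow> {#\<tau>, \<tau>, \<sigma>, \<sigma>#}
       | Inr (Inr (\<iota>, \<tau>, \<sigma>)) \<Rightarrow> {#\<tau>, \<tau>, \<sigma>#})")
    (auto simp: mult_descent intro!: wf_mult wf_trancl wf_elt_rel dest: entries_below ndom_below)

declare bval_mem.simps [simp del] bval_eq.simps [simp del] bval_sub.simps [simp del]

function check :: "('b::{boolean_algebra, complete_lattice} \<Rightarrow> 'v::zfc_universe) \<Rightarrow> 'v \<Rightarrow> 'v" where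
  "check \<iota> x = vset ((\<lambda>y. vpair (check \<iota> y) (\<iota> \<top>)) ` elts x)"
  by auto
termination
  by (relation "inv_image elt_rel snd") (rule wf_inv_image[OF wf_elt_rel], simp_all add: elt_rel_def)

declare check.simps [simp del]

definition bval_ground ::
  "('b::{boolean_algebra, complete_lattice} \<Rightarrow> 'v::zfc_universe) \<Rightarrow> 'v \<Rightarrow> 'b" where
  "bval_ground \<iota> \<tau> = (\<Squnion>x. bval_eq \<iota> \<tau> (check \<iota> x))"


section \<open>The Boolean ultrapower\<close>

text \<open>The class of \<open>\<tau>\<close> modulo \<open>=\<^sub>U\<close>, cut down to its members of minimal rank.\<close>

definition full_class ::
  "('b::{boolean_algebra, complete_lattice} \<Rightarrow> 'v::zfc_universe) \<Rightarrow> 'b set \<Rightarrow> 'v \<Rightarrow> 'v set" where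
  "full_class \<iota> U \<tau> = {\<sigma>. bname \<iota> \<sigma> \<and> bval_eq \<iota> \<tau> \<sigma> \<in> U}"

definition bclass ::
  "('b::{boolean_algebra, complete_lattice} \<Rightarrow> 'v::zfc_universe) \<Rightarrow> 'b set \<Rightarrow> 'v \<Rightarrow> 'v set" where
  "bclass \<iota> U \<tau> =
     {\<sigma> \<in> full_class \<iota> U \<tau>. \<forall>\<rho>\<in>full_class \<iota> U \<tau>. rank \<rho> \<notin> elts (rank \<sigma>)}"

definition boolean_ultrapower ::
  "('b::{boolean_algebra, complete_lattice} \<Rightarrow> 'v::zfc_universe) \<Rightarrow> 'b set \<Rightarrow> 'v set set" where
  "boolean_ultrapower \<iota> U = {bclass \<iota> U \<tau> | \<tau>. bname \<iota> \<tau> \<and> bval_ground \<iota> \<tau> \<in> U}"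

definition boolean_ultrapower_mem ::
  "('b::{boolean_algebra, complete_lattice} \<Rightarrow> 'v::zfc_universe) \<Rightarrow> 'b set \<Rightarrow>
   'v set \<Rightarrow> 'v set \<Rightarrow> bool" where
  "boolean_ultrapower_mem \<iota> U X Y \<longleftrightarrow> (\<exists>\<tau>\<in>X. \<exists>\<sigma>\<in>Y. bval_mem \<iota> \<tau> \<sigma> \<in> U)"

definition boolean_ultrapower_emb ::
  "('b::{boolean_algebra, complete_lattice} \<Rightarrow> 'v::zfc_universe) \<Rightarrow> 'b set \<Rightarrow> 'v \<Rightarrow> 'v set" where
  "boolean_ultrapower_emb \<iota> U x = bclass \<iota> U (check \<iota> x)"


section \<open>Power set ultrapowers\<close>

definition induced_ultrafilter ::
  "'b::{boolean_algebra, complete_lattice} set \<Rightarrow> 'b set \<Rightarrow> 'b set set" where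
  "induced_ultrafilter U A = {X. X \<subseteq> A \<and> \<Squnion>X \<in> U}"

text \<open>
  The classical ultrapower of \<open>V\<close> by a collection \<open>W\<close> of subsets of \<open>A\<close>.  Functions on \<open>A\<close> are
  represented by the HOL functions in \<open>extensional A\<close>.
\<close>

definition fclass :: "'b set \<Rightarrow> 'b set set \<Rightarrow> ('b \<Rightarrow> 'v::zfc_universe) \<Rightarrow> ('b \<Rightarrow> 'v) set" where
  "fclass A W f = {g \<in> extensional A. {a \<in> A. f a = g a} \<in> W}"

definition ultrapower :: "'b set \<Rightarrow> 'b set set \<Rightarrow> ('b \<Rightarrow> 'v::zfc_universe) set set" where
  "ultrapower A W = fclass A W ` extensional A"

definition ultrapower_mem ::
  "'b set \<Rightarrow> 'b set set \<Rightarrow> ('b \<Rightarrow> 'v::zfc_universe) set \<Rightarrow> ('b \<Rightarrow> 'v) set \<Rightarrow> bool" where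
  "ultrapower_mem A W X Y \<longleftrightarrow> (\<exists>f\<in>X. \<exists>g\<in>Y. {a \<in> A. f a \<in> elts (g a)} \<in> W)"

definition ultrapower_emb :: "'b set \<Rightarrow> 'b set set \<Rightarrow> 'v::zfc_universe \<Rightarrow> ('b \<Rightarrow> 'v) set" where
  "ultrapower_emb A W x = fclass A W (\<lambda>a\<in>A. x)"

text \<open>The function \<open>f \<down> B\<close>, for \<open>f\<close> on \<open>A\<close> and \<open>B\<close> refining \<open>A\<close>.\<close>

definition reduce :: "'b::boolean_algebra set \<Rightarrow> 'b set \<Rightarrow> ('b \<Rightarrow> 'v) \<Rightarrow> ('b \<Rightarrow> 'v)" where
  "reduce A B f = (\<lambda>b\<in>B. f (THE a. a \<in> A \<and> b \<le> a))"

text \<open>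
  The map \<open>\<pi>\<^bsub>A,B\<^esub>\<close> sending the class of \<open>f\<close> to the class of \<open>f \<down> B\<close>.  As this does not
  depend on the choice of \<open>f\<close>, the union below is over a family with just one member.
\<close>

definition transition ::
  "'b::{boolean_algebra, complete_lattice} set \<Rightarrow> 'b set \<Rightarrow> 'b set \<Rightarrow>
   ('b \<Rightarrow> 'v::zfc_universe) set \<Rightarrow> ('b \<Rightarrow> 'v) set" where
  "transition U A B X = (\<Union>f\<in>X. fclass B (induced_ultrafilter U B) (reduce A B f))"


section \<open>Direct limits\<close>

text \<open>
  A directed system has an index set \<open>I\<close>, a relation \<open>le\<close> on \<open>I\<close>, structures \<open>M i\<close> with binary
  relations \<open>E i\<close>, and maps \<open>\<pi> i j\<close> from \<open>M i\<close> to \<open>M j\<close> for \<open>le i j\<close>.  The threads are the classes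
  of the least equivalence relation identifying every \<open>x \<in> M i\<close> with all its images \<open>\<pi> i j x\<close>;
  elements of the disjoint union are pairs \<open>(i, x)\<close>.
\<close>

definition identify ::
  "'i set \<Rightarrow> ('i \<Rightarrow> 'i \<Rightarrow> bool) \<Rightarrow> ('i \<Rightarrow> 'm set) \<Rightarrow> ('i \<Rightarrow> 'i \<Rightarrow> 'm \<Rightarrow> 'm) \<Rightarrow>
   'i \<times> 'm \<Rightarrow> 'i \<times> 'm \<Rightarrow> bool" where
  "identify I le M \<pi> = (\<lambda>(i, x) (j, y). i \<in> I \<and> j \<in> I \<and> le i j \<and> x \<in> M i \<and> y = \<pi> i j x)"

definition thread ::
  "'i set \<Rightarrow> ('i \<Rightarrow> 'i \<Rightarrow> bool) \<Rightarrow> ('i \<Rightarrow> 'm set) \<Rightarrow> ('i \<Rightarrow> 'i \<Rightarrow> 'm \<Rightarrow> 'm) \<Rightarrow>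
   'i \<Rightarrow> 'm \<Rightarrow> ('i \<times> 'm) set" where
  "thread I le M \<pi> i x = {q. equivclp (identify I le M \<pi>) (i, x) q}"

definition direct_limit ::
  "'i set \<Rightarrow> ('i \<Rightarrow> 'i \<Rightarrow> bool) \<Rightarrow> ('i \<Rightarrow> 'm set) \<Rightarrow> ('i \<Rightarrow> 'i \<Rightarrow> 'm \<Rightarrow> 'm) \<Rightarrow>
   ('i \<times> 'm) set set" where
  "direct_limit I le M \<pi> = {thread I le M \<pi> i x | i x. i \<in> I \<and> x \<in> M i}"

definition direct_limit_rel ::
  "('i \<Rightarrow> 'm \<Rightarrow> 'm \<Rightarrow> bool) \<Rightarrow> ('i \<times> 'm) set \<Rightarrow> ('i \<times> 'm) set \<Rightarrow> bool" where
  "direct_limit_rel E s t \<longleftrightarrow> (\<exists>i x y. (i, x) \<in> s \<and> (i, y) \<in> t \<and> E i x y)"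

text \<open>
  The system of the power set ultrapowers.  The index \<open>A\<close> is below the index \<open>B\<close> iff \<open>B\<close> refines
  \<open>A\<close>.
\<close>

abbreviation "sys_index \<equiv> Collect maximal_antichain"

abbreviation "sys_le A B \<equiv> refines B A"

definition sys_model ::
  "'b::{boolean_algebra, complete_lattice} set \<Rightarrow> 'b set \<Rightarrow> ('b \<Rightarrow> 'v::zfc_universe) set set" where
  "sys_model U A = ultrapower A (induced_ultrafilter U A)"

definition sys_mem ::
  "'b::{boolean_algebra, complete_lattice} set \<Rightarrow> 'b set \<Rightarrow>
   ('b \<Rightarrow> 'v::zfc_universe) set \<Rightarrow> ('b \<Rightarrow> 'v) set \<Rightarrow> bool" where
  "sys_mem U A = ultrapower_mem A (induced_ultrafilter U A)"

definition sys_emb ::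
  "'b::{boolean_algebra, complete_lattice} set \<Rightarrow> 'b set \<Rightarrow>
   'v::zfc_universe \<Rightarrow> ('b \<Rightarrow> 'v) set" where
  "sys_emb U A = ultrapower_emb A (induced_ultrafilter U A)"

definition sys_thread ::
  "'b::{boolean_algebra, complete_lattice} set \<Rightarrow> 'b set \<Rightarrow>
   ('b \<Rightarrow> 'v::zfc_universe) set \<Rightarrow> ('b set \<times> ('b \<Rightarrow> 'v) set) set" where
  "sys_thread U = thread sys_index sys_le (sys_model U) (transition U)"

definition sys_limit ::
  "'b::{boolean_algebra, complete_lattice} set \<Rightarrow>
   ('b set \<times> ('b \<Rightarrow> 'v::zfc_universe) set) set set" where
  "sys_limit U = direct_limit sys_index sys_le (sys_model U) (transition U)"

definition sys_limit_mem ::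
  "'b::{boolean_algebra, complete_lattice} set \<Rightarrow>
   ('b set \<times> ('b \<Rightarrow> 'v::zfc_universe) set) set \<Rightarrow> ('b set \<times> ('b \<Rightarrow> 'v) set) set \<Rightarrow> bool" where
  "sys_limit_mem U = direct_limit_rel (sys_mem U)"

end

theory Submission
  imports Defs
begin

text \<open>
  Both structures are quotients of one and the same structure.  A \<^emph>\<open>Boolean-valued element\<close> of
  \<open>V\<close> is a map \<open>\<phi>\<close> from \<open>V\<close> to the algebra with pairwise disjoint values whose join lies in \<open>U\<close>;
  \<open>\<phi> x\<close> is thought of as the truth value of ``the element is \<open>x\<close>''.  A relation \<open>R\<close> on \<open>V\<close>
  extends to such maps with the value \<open>\<Squnion>{\<phi> x \<sqinter> \<psi> y | R x y}\<close> (\<open>bool_rel\<close>), and is taken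
  to hold if this value lies in \<open>U\<close>; the extended equality is a congruence for all extended
  relations (\<open>bool_rel_cong\<close>).

  A name \<open>\<tau>\<close> with \<open>\<lbrakk>\<tau> \<in> V\<rbrakk> \<in> U\<close> yields the element \<open>x \<mapsto> \<lbrakk>\<tau> = check x\<rbrakk>\<close> (\<open>ground_val\<close>), and since
  check names have two-valued truth values, \<open>=\<^sub>U\<close> and \<open>\<in>\<^sub>U\<close> between names are the extended equality
  and membership (\<open>bval_iff_bool_rel\<close>).  A function \<open>f\<close> on a maximal antichain \<open>A\<close> yields the
  element \<open>x \<mapsto> \<Squnion>{a \<in> A. f a = x}\<close> (\<open>step_val\<close>), and equality and membership in the ultrapower by
  \<open>U\<^sub>A\<close> are again the extended ones (\<open>bool_rel_step_val\<close>).  Passing from \<open>f\<close> to its reduction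
  to a finer antichain does not change this element at all (\<open>step_val_reduce\<close>).  As two antichains
  have a common refinement, the thread of the class of \<open>f\<close> therefore consists exactly of the classes
  of the functions with an equivalent element (\<open>mem_sys_thread_iff\<close>).

  It remains to see that both kinds of representatives exhaust the Boolean-valued elements up to
  equivalence.  The nonzero values of \<open>\<phi>\<close>, with the complement of their join, form a maximal
  antichain, on which the function sending \<open>\<phi> x\<close> to \<open>x\<close> represents \<open>\<phi>\<close>
  (\<open>ex_step_val\<close>); and the names \<open>check (f a)\<close> can be mixed along the antichain into a single name
  (\<open>ex_mixed_name\<close>).  The isomorphism relates a name and a function with equivalent elements.
\<close>

section \<open>Complete Boolean algebras, ultrafilters and antichains\<close>

text \<open>
  Meeting with a fixed element has a right adjoint, hence preserves arbitrary joins.  This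
  finite-by-infinite distributive law holds in every complete Boolean algebra, unlike complete
  distributivity; it is used in the form of this rule and the next.
\<close>

lemma SUP_inf_leI:
  fixes a c :: "'b::{boolean_algebra, complete_lattice}"
  assumes "\<And>i. i \<in> I \<Longrightarrow> f i \<sqinter> a \<le> c"
  shows "(\<Squnion>i\<in>I. f i) \<sqinter> a \<le> c"
  using assms unfolding shunt1 by (blast intro: SUP_least)

lemma SUP_inf_SUP_leI:
  fixes c :: "'b::{boolean_algebra, complete_lattice}"
  assumes "\<And>i j. i \<in> I \<Longrightarrow> j \<in> J \<Longrightarrow> f i \<sqinter> g j \<le> c"
  shows "(\<Squnion>i\<in>I. f i) \<sqinter> (\<Squnion>j\<in>J. g j) \<le> c"
proof (rule SUP_inf_leI)
  fix i assume "i \<in> I"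
  then have "(\<Squnion>j\<in>J. g j) \<sqinter> f i \<le> c"
    using assms by (intro SUP_inf_leI) (simp add: inf_commute)
  then show "f i \<sqinter> (\<Squnion>j\<in>J. g j) \<le> c"
    by (simp add: inf_commute)
qed

lemma ultrafilter_upward: "ultrafilter U \<Longrightarrow> a \<in> U \<Longrightarrow> a \<le> b \<Longrightarrow> b \<in> U"
  unfolding ultrafilter_def by blast

lemma ultrafilter_inf: "ultrafilter U \<Longrightarrow> a \<in> U \<Longrightarrow> b \<in> U \<Longrightarrow> a \<sqinter> b \<in> U"
  unfolding ultrafilter_def by blast

lemma ultrafilter_top: "ultrafilter U \<Longrightarrow> \<top> \<in> U"
  unfolding ultrafilter_def by blast

lemma antichain_disjoint: "antichain A \<Longrightarrow> a \<in> A \<Longrightarrow> b \<in> A \<Longrightarrow> a \<noteq> b \<Longrightarrow> a \<sqinter> b = \<bottom>"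
  unfolding antichain_def by blast

text \<open>An antichain whose join is not \<open>\<top>\<close> is extended by the complement of its join.\<close>

lemma maximal_antichain_iff:
  fixes A :: "'b::{boolean_algebra, complete_lattice} set"
  shows "maximal_antichain A \<longleftrightarrow> antichain A \<and> \<Squnion>A = \<top>"
proof (intro iffI conjI)
  assume max: "maximal_antichain A"
  then show anti: "antichain A"
    unfolding maximal_antichain_def by blast
  show "\<Squnion>A = \<top>"
  proof (rule ccontr)
    assume "\<Squnion>A \<noteq> \<top>"
    then have nz: "- \<Squnion>A \<noteq> \<bottom>"
      by (metis compl_bot_eq double_compl)
    have disj: "a \<sqinter> - \<Squnion>A = \<bottom>" "- \<Squnion>A \<sqinter> a = \<bottom>" if "a \<in> A" for a
    proof -
      have "a \<sqinter> - \<Squnion>A \<le> \<Squnion>A \<sqinter> - \<Squnion>A"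
        using that by (intro inf_mono Sup_upper order_refl)
      then show "a \<sqinter> - \<Squnion>A = \<bottom>"
        by (simp add: bot_unique)
      then show "- \<Squnion>A \<sqinter> a = \<bottom>"
        by (simp add: inf_commute)
    qed
    have "antichain (insert (- \<Squnion>A) A)"
      using anti nz disj unfolding antichain_def by auto
    then have "- \<Squnion>A \<in> A"
      using max unfolding maximal_antichain_def by blast
    then show False
      using disj[of "- \<Squnion>A"] nz by simp
  qed
next
  assume A: "antichain A \<and> \<Squnion>A = \<top>"
  have "a \<in> A" if "antichain A'" "A \<subseteq> A'" "a \<in> A'" for A' a
  proof (rule ccontr)
    assume "a \<notin> A"
    then have "b \<sqinter> a \<le> \<bottom>" if "b \<in> A" for b
      using that \<open>antichain A'\<close> \<open>A \<subseteq> A'\<close> \<open>a \<in> A'\<close> by (metis antichain_disjoint order_refl subsetD)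
    then have "\<Squnion>A \<sqinter> a \<le> \<bottom>"
      using SUP_inf_leI[of A "\<lambda>b. b" a \<bottom>] by simp
    then show False
      using A \<open>antichain A'\<close> \<open>a \<in> A'\<close> unfolding antichain_def by (simp add: bot_unique)
  qed
  then show "maximal_antichain A"
    using A unfolding maximal_antichain_def by blast
qed

lemma common_refinement:
  fixes A B :: "'b::{boolean_algebra, complete_lattice} set"
  assumes A: "maximal_antichain A" and B: "maximal_antichain B"
  obtains C where "maximal_antichain C" "refines C A" "refines C B"
proof
  define C where "C = {a \<sqinter> b | a b. a \<in> A \<and> b \<in> B} - {\<bottom>}"
  have anti: "antichain A" "antichain B" and top: "\<Squnion>A = \<top>" "\<Squnion>B = \<top>"
    using A B by (simp_all add: maximal_antichain_iff)
  have disj: "(a \<sqinter> b) \<sqinter> (a' \<sqinter> b') = \<bottom>"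
    if "a \<in> A" "a' \<in> A" "b \<in> B" "b' \<in> B" "a \<sqinter> b \<noteq> a' \<sqinter> b'" for a a' b b'
  proof -
    have "a \<sqinter> a' = \<bottom> \<or> b \<sqinter> b' = \<bottom>"
      using that anti antichain_disjoint by metis
    moreover have "(a \<sqinter> b) \<sqinter> (a' \<sqinter> b') = (a \<sqinter> a') \<sqinter> (b \<sqinter> b')"
      by (simp add: inf_assoc inf_left_commute)
    ultimately show ?thesis
      by auto
  qed
  have "antichain C"
    unfolding antichain_def C_def using disj by blast
  moreover have "\<Squnion>C = \<top>"
  proof -
    have "(\<Squnion>a\<in>A. a) \<sqinter> (\<Squnion>b\<in>B. b) \<le> \<Squnion>C"
    proof (rule SUP_inf_SUP_leI)
      fix a b assume "a \<in> A" "b \<in> B"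
      then show "a \<sqinter> b \<le> \<Squnion>C"
        by (cases "a \<sqinter> b = \<bottom>") (auto simp: C_def intro!: Sup_upper)
    qed
    then show ?thesis
      using top by (simp add: top_unique)
  qed
  ultimately show "maximal_antichain C"
    by (simp add: maximal_antichain_iff)
  show "refines C A" "refines C B"
    unfolding refines_def C_def by (auto intro: inf_le1 inf_le2)
qed


section \<open>Boolean-valued elements\<close>

definition boolean_element :: "'b::{boolean_algebra, complete_lattice} set \<Rightarrow> ('v \<Rightarrow> 'b) \<Rightarrow> bool" where
  "boolean_element U \<phi> \<longleftrightarrow> (\<forall>x y. x \<noteq> y \<longrightarrow> \<phi> x \<sqinter> \<phi> y = \<bottom>) \<and> (\<Squnion>x. \<phi> x) \<in> U"

definition bool_rel ::
  "('v \<Rightarrow> 'v \<Rightarrow> bool) \<Rightarrow> ('v \<Rightarrow> 'b::{boolean_algebra, complete_lattice}) \<Rightarrow> ('v \<Rightarrow> 'b) \<Rightarrow> 'b" where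
  "bool_rel R \<phi> \<psi> = (\<Squnion>(x, y)\<in>{(x, y). R x y}. \<phi> x \<sqinter> \<psi> y)"

lemma boolean_element_disjoint: "boolean_element U \<phi> \<Longrightarrow> x \<noteq> y \<Longrightarrow> \<phi> x \<sqinter> \<phi> y = \<bottom>"
  unfolding boolean_element_def by blast

lemma bool_rel_upper: "R x y \<Longrightarrow> \<phi> x \<sqinter> \<psi> y \<le> bool_rel R \<phi> \<psi>"
  unfolding bool_rel_def by (intro SUP_upper2[of "(x, y)"]) auto

lemma bool_rel_least: "(\<And>x y. R x y \<Longrightarrow> \<phi> x \<sqinter> \<psi> y \<le> c) \<Longrightarrow> bool_rel R \<phi> \<psi> \<le> c"
  unfolding bool_rel_def by (intro SUP_least) auto

lemma bool_rel_eq_refl: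
  fixes \<phi> :: "'v \<Rightarrow> 'b::{boolean_algebra, complete_lattice}"
  assumes "ultrafilter U" "boolean_element U \<phi>"
  shows "bool_rel (=) \<phi> \<phi> \<in> U"
proof -
  have "(\<Squnion>x. \<phi> x) \<le> bool_rel (=) \<phi> \<phi>"
    using bool_rel_upper[of "(=)" _ _ \<phi> \<phi>] by (intro SUP_least) simp
  then show ?thesis
    using assms ultrafilter_upward unfolding boolean_element_def by blast
qed

text \<open>
  Where the two joins meet, disjointness of the values of \<open>\<phi>\<close> forces their first coordinates to agree.
\<close>

lemma bool_rel_subst_left:
  assumes "boolean_element U \<phi>"
  shows "bool_rel R \<phi> \<psi> \<sqinter> bool_rel (=) \<phi> \<phi>' \<le> bool_rel R \<phi>' \<psi>"
  unfolding bool_rel_def[of R \<phi> \<psi>] bool_rel_def[of "(=)"]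
proof (rule SUP_inf_SUP_leI, clarsimp)
  fix x y z assume R: "R x y"
  show "\<phi> x \<sqinter> \<psi> y \<sqinter> (\<phi> z \<sqinter> \<phi>' z) \<le> bool_rel R \<phi>' \<psi>"
  proof (cases "x = z")
    case True
    have "\<phi> x \<sqinter> \<psi> y \<sqinter> (\<phi> z \<sqinter> \<phi>' z) \<le> \<phi>' x \<sqinter> \<psi> y"
      using True by (simp add: le_infI1 le_infI2)
    then show ?thesis
      using bool_rel_upper[of R x y \<phi>' \<psi>] R by (blast intro: order_trans)
  next
    case False
    have "\<phi> x \<sqinter> \<psi> y \<sqinter> (\<phi> z \<sqinter> \<phi>' z) \<le> \<phi> x \<sqinter> \<phi> z"
      by (simp add: le_infI1 le_infI2)
    then show ?thesis
      using boolean_element_disjoint[OF assms False] by (simp add: bot_unique)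
  qed
qed

lemma bool_rel_converse: "bool_rel (\<lambda>x y. R y x) \<psi> \<phi> = bool_rel R \<phi> \<psi>"
proof (intro antisym bool_rel_least)
  fix x y assume "R y x"
  then show "\<psi> x \<sqinter> \<phi> y \<le> bool_rel R \<phi> \<psi>"
    by (subst inf_commute) (rule bool_rel_upper)
next
  fix x y assume "R x y"
  then show "\<phi> x \<sqinter> \<psi> y \<le> bool_rel (\<lambda>x y. R y x) \<psi> \<phi>"
    by (subst inf_commute) (rule bool_rel_upper)
qed

lemma bool_rel_eq_sym: "bool_rel (=) \<phi> \<psi> = bool_rel (=) \<psi> \<phi>"
proof -
  have "(\<lambda>x y. y = x) = (=)"
    by (intro ext) (rule eq_commute)
  then show ?thesis
    using bool_rel_converse[of "(=)" \<phi> \<psi>] by metis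
qed

text \<open>Congruence of the extended equality; the case \<open>R = (=)\<close> is its transitivity.\<close>

lemma bool_rel_cong:
  assumes U: "ultrafilter U" and "boolean_element U \<phi>" "boolean_element U \<psi>"
    and eq: "bool_rel (=) \<phi> \<phi>' \<in> U" "bool_rel (=) \<psi> \<psi>' \<in> U" and R: "bool_rel R \<phi> \<psi> \<in> U"
  shows "bool_rel R \<phi>' \<psi>' \<in> U"
proof -
  have "bool_rel R \<phi>' \<psi> \<in> U"
    using bool_rel_subst_left[OF assms(2)] R eq(1) U ultrafilter_inf ultrafilter_upward by metis
  then have "bool_rel (\<lambda>x y. R y x) \<psi> \<phi>' \<in> U"
    by (simp only: bool_rel_converse[of R])
  then have "bool_rel (\<lambda>x y. R y x) \<psi>' \<phi>' \<in> U"
    using bool_rel_subst_left[OF assms(3)] eq(2) U ultrafilter_inf ultrafilter_upward by metis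
  then show ?thesis
    by (simp only: bool_rel_converse[of R])
qed

lemma bool_rel_cong_iff:
  assumes U: "ultrafilter U" and "boolean_element U \<phi>" "boolean_element U \<psi>"
    and "boolean_element U \<phi>'" "boolean_element U \<psi>'"
    and "bool_rel (=) \<phi> \<phi>' \<in> U" "bool_rel (=) \<psi> \<psi>' \<in> U"
  shows "bool_rel R \<phi> \<psi> \<in> U \<longleftrightarrow> bool_rel R \<phi>' \<psi>' \<in> U"
  using assms bool_rel_cong[of U \<phi> \<psi> \<phi>' \<psi>' R] bool_rel_cong[of U \<phi>' \<psi>' \<phi> \<psi> R]
  by (auto simp: bool_rel_eq_sym)

lemma bool_rel_eq_trans:
  assumes "ultrafilter U" "boolean_element U \<phi>" "boolean_element U \<psi>"
    and "bool_rel (=) \<phi> \<psi> \<in> U" "bool_rel (=) \<psi> \<chi> \<in> U"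
  shows "bool_rel (=) \<phi> \<chi> \<in> U"
  using bool_rel_cong[OF assms(1-3) bool_rel_eq_refl[OF assms(1,2)] assms(5,4)] .


section \<open>Functions on antichains\<close>

definition step_val :: "'b::{boolean_algebra, complete_lattice} set \<Rightarrow> ('b \<Rightarrow> 'v) \<Rightarrow> 'v \<Rightarrow> 'b" where
  "step_val A f x = \<Squnion>{a \<in> A. f a = x}"

lemma step_val_upper: "a \<in> A \<Longrightarrow> a \<le> step_val A f (f a)"
  unfolding step_val_def by (intro Sup_upper) simp

lemma step_val_inf_leI:
  assumes "\<And>a b. a \<in> A \<Longrightarrow> f a = x \<Longrightarrow> b \<in> B \<Longrightarrow> g b = y \<Longrightarrow> a \<sqinter> b \<le> c"
  shows "step_val A f x \<sqinter> step_val B g y \<le> c"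
  using SUP_inf_SUP_leI[of "{a \<in> A. f a = x}" "{b \<in> B. g b = y}" "\<lambda>a. a" "\<lambda>b. b" c] assms
  by (simp add: step_val_def)

text \<open>
  Off the diagonal two members of an antichain are disjoint, so only the pairs \<open>(a, a)\<close> contribute
  to the value of \<open>R\<close>.
\<close>

lemma bool_rel_step_val:
  assumes "antichain A"
  shows "bool_rel R (step_val A f) (step_val A g) = \<Squnion>{a \<in> A. R (f a) (g a)}"
proof (rule antisym)
  show "bool_rel R (step_val A f) (step_val A g) \<le> \<Squnion>{a \<in> A. R (f a) (g a)}"
  proof (intro bool_rel_least step_val_inf_leI)
    fix x y a b
    assume "R x y" "a \<in> A" "f a = x" "b \<in> A" "g b = y"
    then show "a \<sqinter> b \<le> \<Squnion>{a \<in> A. R (f a) (g a)}"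
      using antichain_disjoint[OF assms, of a b] by (cases "a = b") (auto intro: Sup_upper)
  qed
  show "\<Squnion>{a \<in> A. R (f a) (g a)} \<le> bool_rel R (step_val A f) (step_val A g)"
  proof (rule Sup_least, clarsimp)
    fix a assume a: "a \<in> A" "R (f a) (g a)"
    then have "a \<le> step_val A f (f a) \<sqinter> step_val A g (g a)"
      by (simp add: step_val_upper)
    also have "\<dots> \<le> bool_rel R (step_val A f) (step_val A g)"
      using a(2) by (rule bool_rel_upper)
    finally show "a \<le> bool_rel R (step_val A f) (step_val A g)" .
  qed
qed

lemma step_val_boolean_element:
  fixes f :: "'b::{boolean_algebra, complete_lattice} \<Rightarrow> 'v"
  assumes "ultrafilter U" "maximal_antichain A"
  shows "boolean_element U (step_val A f)"
  unfolding boolean_element_def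
proof (intro conjI allI impI)
  have A: "antichain A" "\<Squnion>A = \<top>"
    using assms(2) by (simp_all add: maximal_antichain_iff)
  fix x y :: 'v assume "x \<noteq> y"
  then have "step_val A f x \<sqinter> step_val A f y \<le> \<bottom>"
    using antichain_disjoint[OF A(1)] by (intro step_val_inf_leI) (metis order_refl)
  then show "step_val A f x \<sqinter> step_val A f y = \<bottom>"
    by (simp add: bot_unique)
next
  have "\<Squnion>A \<le> (\<Squnion>x. step_val A f x)"
    by (rule Sup_least) (blast intro: SUP_upper2 step_val_upper)
  then have "(\<Squnion>x. step_val A f x) = \<top>"
    using assms(2) by (simp add: maximal_antichain_iff top_unique)
  then show "(\<Squnion>x. step_val A f x) \<in> U"
    using assms(1) by (simp add: ultrafilter_top)
qed

lemma reduce_eq: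
  fixes A :: "'b::{boolean_algebra, complete_lattice} set"
  assumes A: "maximal_antichain A" and B: "maximal_antichain B"
    and "a \<in> A" "b \<in> B" "b \<le> a"
  shows "reduce A B f b = f a"
proof -
  have "a' = a" if "a' \<in> A" "b \<le> a'" for a'
  proof (rule ccontr)
    assume "a' \<noteq> a"
    then have "a' \<sqinter> a = \<bottom>"
      using A that(1) assms(3) antichain_disjoint[of A a' a] by (simp add: maximal_antichain_iff)
    then have "b = \<bottom>"
      using that(2) assms(5) by (metis bot_unique inf_greatest)
    then show False
      using B assms(4) by (auto simp: maximal_antichain_iff antichain_def)
  qed
  then have "(THE a. a \<in> A \<and> b \<le> a) = a"
    using assms(3,5) by (blast intro: the_equality)
  then show ?thesis
    using assms(4) by (simp add: reduce_def)
qed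

lemma reduce_extensional: "reduce A B f \<in> extensional B"
  by (simp add: reduce_def)

text \<open>Each member of \<open>A\<close> is the join of the members of \<open>B\<close> below it.\<close>

lemma step_val_reduce:
  assumes A: "maximal_antichain A" and B: "maximal_antichain B" and ref: "refines B A"
  shows "step_val B (reduce A B f) = step_val A f"
proof (intro ext antisym)
  fix x
  show "step_val B (reduce A B f) x \<le> step_val A f x"
    unfolding step_val_def[of B]
  proof (rule Sup_least, clarsimp)
    fix b assume b: "b \<in> B" "x = reduce A B f b"
    obtain a where a: "a \<in> A" "b \<le> a"
      using ref b(1) unfolding refines_def by blast
    have "reduce A B f b = f a"
      using A B a(1) b(1) a(2) by (rule reduce_eq)
    then show "b \<le> step_val A f (reduce A B f b)"
      using step_val_upper[OF a(1), of f] a(2) by (metis order_trans)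
  qed
  show "step_val A f x \<le> step_val B (reduce A B f) x"
    unfolding step_val_def[of A]
  proof (rule Sup_least, clarsimp)
    fix a assume a: "a \<in> A" "x = f a"
    have "(\<Squnion>b\<in>B. b) \<sqinter> a \<le> step_val B (reduce A B f) (f a)"
    proof (rule SUP_inf_leI)
      fix b assume b: "b \<in> B"
      obtain a' where a': "a' \<in> A" "b \<le> a'"
        using ref b unfolding refines_def by blast
      show "b \<sqinter> a \<le> step_val B (reduce A B f) (f a)"
      proof (cases "a' = a")
        case True
        then have "reduce A B f b = f a"
          using reduce_eq[OF A B a(1) b] a' by simp
        then show ?thesis
          using step_val_upper[OF b, of "reduce A B f"] by (metis le_infI1)
      next
        case False
        have "b \<sqinter> a \<le> a' \<sqinter> a"
          using a'(2) by (intro inf_mono order_refl)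
        also have "\<dots> = \<bottom>"
          using A a'(1) a(1) False by (simp add: maximal_antichain_iff antichain_disjoint[of A])
        finally show ?thesis
          by (simp add: bot_unique)
      qed
    qed
    then show "a \<le> step_val B (reduce A B f) (f a)"
      using B by (simp add: maximal_antichain_iff)
  qed
qed

text \<open>
  The antichain consists of the nonzero values of \<open>\<phi>\<close> and the complement of their join.  A nonzero
  value is attained only once, so \<open>\<phi> x \<mapsto> x\<close> is a function; at the complement any value
  will do, because the join of \<open>\<phi>\<close> lies in \<open>U\<close>.
\<close>

lemma ex_step_val:
  fixes \<phi> :: "'v \<Rightarrow> 'b::{boolean_algebra, complete_lattice}"
  assumes U: "ultrafilter U" and \<phi>: "boolean_element U \<phi>"
  obtains A f where "maximal_antichain A" "f \<in> extensional A" "bool_rel (=) \<phi> (step_val A f) \<in> U"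
proof
  define s where "s = (\<Squnion>x. \<phi> x)"
  define A where "A = insert (- s) (range \<phi>) - {\<bottom>}"
  define f where "f = (\<lambda>a\<in>A. SOME x. \<phi> x = a)"
  have le: "\<phi> x \<le> s" for x
    unfolding s_def by (rule SUP_upper) simp
  have compl: "\<phi> x \<sqinter> - s = \<bottom>" "- s \<sqinter> \<phi> x = \<bottom>" for x
  proof -
    show "\<phi> x \<sqinter> - s = \<bottom>"
      using le[of x] by (simp only: inf_shunt double_compl)
    then show "- s \<sqinter> \<phi> x = \<bottom>"
      by (simp only: inf_commute)
  qed
  have "a \<sqinter> b = \<bottom>" if "a \<in> insert (- s) (range \<phi>)" "b \<in> insert (- s) (range \<phi>)" "a \<noteq> b" for a b
    using that(1,2)
  proof (elim insertE imageE)
    fix x y assume "a = \<phi> x" "b = \<phi> y"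
    then show ?thesis
      using that(3) boolean_element_disjoint[OF \<phi>, of x y] by metis
  qed (use that(3) compl in simp_all)
  then have "antichain A"
    unfolding antichain_def A_def by blast
  moreover have "\<Squnion>A = \<top>"
  proof -
    have "c \<le> \<Squnion>A" if "c \<in> insert (- s) (range \<phi>)" for c
      using that unfolding A_def by (cases "c = \<bottom>") (auto intro: Sup_upper)
    then have "s \<le> \<Squnion>A" "- s \<le> \<Squnion>A"
      unfolding s_def by (auto intro: SUP_least)
    then have "s \<squnion> - s \<le> \<Squnion>A"
      by (rule sup_least)
    then show ?thesis
      by (simp add: top_unique)
  qed
  ultimately show "maximal_antichain A"
    by (simp add: maximal_antichain_iff)
  show "f \<in> extensional A"
    by (simp add: f_def)
  have "\<phi> x \<le> step_val A f x" for x
  proof (cases "\<phi> x = \<bottom>")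
    case False
    then have in_A: "\<phi> x \<in> A"
      unfolding A_def by simp
    have "y = x" if "\<phi> y = \<phi> x" for y
      using that boolean_element_disjoint[OF \<phi>, of y x] False by auto
    then have "f (\<phi> x) = x"
      using in_A by (auto simp: f_def intro: some_equality)
    then show ?thesis
      using step_val_upper[OF in_A, of f] by simp
  qed simp
  then have "\<phi> x \<le> \<phi> x \<sqinter> step_val A f x" for x
    by simp
  then have "s \<le> bool_rel (=) \<phi> (step_val A f)"
    using bool_rel_upper[of "(=)" _ _ \<phi> "step_val A f"]
    unfolding s_def by (intro SUP_least) (blast intro: order_trans)
  then show "bool_rel (=) \<phi> (step_val A f) \<in> U"
    using \<phi> U unfolding boolean_element_def s_def by (blast intro: ultrafilter_upward)
qed


section \<open>The direct limit in terms of Boolean-valued elements\<close>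

abbreviation sys_class ::
  "'b::{boolean_algebra, complete_lattice} set \<Rightarrow> 'b set \<Rightarrow> ('b \<Rightarrow> 'v::zfc_universe) \<Rightarrow> ('b \<Rightarrow> 'v) set"
  where "sys_class U A f \<equiv> fclass A (induced_ultrafilter U A) f"

lemma induced_ultrafilter_iff_bool_rel:
  assumes "maximal_antichain A"
  shows "{a \<in> A. R (f a) (g a)} \<in> induced_ultrafilter U A \<longleftrightarrow>
    bool_rel R (step_val A f) (step_val A g) \<in> U"
  using assms by (auto simp: induced_ultrafilter_def bool_rel_step_val maximal_antichain_iff)

lemma mem_sys_class_iff:
  assumes "maximal_antichain A"
  shows "g \<in> sys_class U A f \<longleftrightarrow>
    g \<in> extensional A \<and> bool_rel (=) (step_val A f) (step_val A g) \<in> U"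
  using induced_ultrafilter_iff_bool_rel[OF assms, of "(=)" f g U] by (simp add: fclass_def)

lemma sys_class_eq_iff:
  assumes U: "ultrafilter U" and A: "maximal_antichain A"
    and f: "f \<in> extensional A" and g: "g \<in> extensional A"
  shows "sys_class U A f = sys_class U A g \<longleftrightarrow> bool_rel (=) (step_val A f) (step_val A g) \<in> U"
proof
  assume "sys_class U A f = sys_class U A g"
  moreover have "g \<in> sys_class U A g"
    using g bool_rel_eq_refl[OF U step_val_boolean_element[OF U A]]
    by (simp add: mem_sys_class_iff[OF A])
  ultimately show "bool_rel (=) (step_val A f) (step_val A g) \<in> U"
    by (metis mem_sys_class_iff[OF A])
next
  assume eq: "bool_rel (=) (step_val A f) (step_val A g) \<in> U"
  have "bool_rel (=) (step_val A f) (step_val A k) \<in> U \<longleftrightarrow>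
      bool_rel (=) (step_val A g) (step_val A k) \<in> U" for k
    by (intro bool_rel_cong_iff[OF U] step_val_boolean_element[OF U A] bool_rel_eq_refl[OF U] eq)
  then show "sys_class U A f = sys_class U A g"
    by (auto simp: mem_sys_class_iff[OF A])
qed

lemma self_mem_sys_class:
  "ultrafilter U \<Longrightarrow> maximal_antichain A \<Longrightarrow> f \<in> extensional A \<Longrightarrow> f \<in> sys_class U A f"
  by (simp add: mem_sys_class_iff bool_rel_eq_refl step_val_boolean_element)

lemma sys_mem_sys_class:
  assumes U: "ultrafilter U" and A: "maximal_antichain A"
    and f: "f \<in> extensional A" and g: "g \<in> extensional A"
  shows "sys_mem U A (sys_class U A f) (sys_class U A g) \<longleftrightarrow>
    bool_rel (\<lambda>x y. x \<in> elts y) (step_val A f) (step_val A g) \<in> U"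
  (is "?L \<longleftrightarrow> ?R")
proof
  assume ?L
  then obtain f' g' where f': "f' \<in> sys_class U A f" and g': "g' \<in> sys_class U A g"
    and R: "{a \<in> A. f' a \<in> elts (g' a)} \<in> induced_ultrafilter U A"
    unfolding sys_mem_def ultrapower_mem_def by blast
  have "bool_rel (\<lambda>x y. x \<in> elts y) (step_val A f') (step_val A g') \<in> U"
    using R induced_ultrafilter_iff_bool_rel[OF A, of "\<lambda>x y. x \<in> elts y" f' g' U] by simp
  moreover have "bool_rel (=) (step_val A f') (step_val A f) \<in> U"
    "bool_rel (=) (step_val A g') (step_val A g) \<in> U"
    using f' g' by (simp_all add: mem_sys_class_iff[OF A] bool_rel_eq_sym)
  ultimately show ?R
    using bool_rel_cong[OF U] step_val_boolean_element[OF U A] by blast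
next
  assume ?R
  then have "{a \<in> A. f a \<in> elts (g a)} \<in> induced_ultrafilter U A"
    using induced_ultrafilter_iff_bool_rel[OF A, of "\<lambda>x y. x \<in> elts y" f g U] by simp
  then show ?L
    unfolding sys_mem_def ultrapower_mem_def
    using self_mem_sys_class[OF U A f] self_mem_sys_class[OF U A g] by blast
qed

lemma transition_sys_class:
  assumes U: "ultrafilter U" and A: "maximal_antichain A" and B: "maximal_antichain B"
    and ref: "refines B A" and f: "f \<in> extensional A"
  shows "transition U A B (sys_class U A f) = sys_class U B (reduce A B f)"
proof -
  have "sys_class U B (reduce A B f') = sys_class U B (reduce A B f)"
    if "f' \<in> sys_class U A f" for f'
  proof -
    have "bool_rel (=) (step_val A f') (step_val A f) \<in> U"
      using that by (simp add: mem_sys_class_iff[OF A] bool_rel_eq_sym)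
    then show ?thesis
      by (simp add: sys_class_eq_iff[OF U B reduce_extensional reduce_extensional]
          step_val_reduce[OF A B ref])
  qed
  then show ?thesis
    unfolding transition_def using self_mem_sys_class[OF U A f] by blast
qed

text \<open>
  Reduction preserves the associated element exactly, so the right-hand side is closed under the
  generating identifications.  Conversely, functions with equivalent elements become equal in the
  ultrapower by a common refinement.
\<close>

lemma mem_sys_thread_iff:
  fixes f :: "'b::{boolean_algebra, complete_lattice} \<Rightarrow> 'v::zfc_universe"
  assumes U: "ultrafilter U" and A: "maximal_antichain A" and f: "f \<in> extensional A"
  shows "(B, Y) \<in> sys_thread U A (sys_class U A f) \<longleftrightarrow>
    maximal_antichain B \<and> (\<exists>g\<in>extensional B. Y = sys_class U B g \<and>
      bool_rel (=) (step_val A f) (step_val B g) \<in> U)"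
  (is "_ \<longleftrightarrow> ?represented B Y")
proof -
  let ?id = "identify sys_index sys_le (sys_model U) (transition U)
    :: 'b set \<times> ('b \<Rightarrow> 'v) set \<Rightarrow> _ \<Rightarrow> bool"
  have id: "?id (C, sys_class U C g) (D, sys_class U D (reduce C D g))"
    if "maximal_antichain C" "maximal_antichain D" "refines D C" "g \<in> extensional C" for C D g
    using that by (simp add: identify_def sys_model_def ultrapower_def transition_sys_class[OF U that])
  have represented_sys_class: "?represented E (sys_class U E k) \<longleftrightarrow>
      bool_rel (=) (step_val A f) (step_val E k) \<in> U"
    if E: "maximal_antichain E" and k: "k \<in> extensional E" for E k
  proof
    assume "?represented E (sys_class U E k)"
    then obtain g where "g \<in> extensional E" "sys_class U E k = sys_class U E g"
      and eq: "bool_rel (=) (step_val A f) (step_val E g) \<in> U"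
      by blast
    then have "bool_rel (=) (step_val E g) (step_val E k) \<in> U"
      using sys_class_eq_iff[OF U E] k by metis
    then show "bool_rel (=) (step_val A f) (step_val E k) \<in> U"
      using step_val_boolean_element[OF U] A E eq bool_rel_eq_trans[OF U] by blast
  next
    assume "bool_rel (=) (step_val A f) (step_val E k) \<in> U"
    then show "?represented E (sys_class U E k)"
      using E k by blast
  qed
  have id_represented: "?represented C X \<longleftrightarrow> ?represented D Y" if CD: "?id (C, X) (D, Y)" for C D X Y
  proof -
    have C: "maximal_antichain C" and D: "maximal_antichain D" and ref: "refines D C"
      using CD by (simp_all add: identify_def)
    obtain g where g: "g \<in> extensional C" and X: "X = sys_class U C g"
      using CD by (auto simp: identify_def sys_model_def ultrapower_def)
    have Y: "Y = sys_class U D (reduce C D g)"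
      using CD transition_sys_class[OF U C D ref g] X by (simp add: identify_def)
    show ?thesis
      unfolding X Y represented_sys_class[OF C g] represented_sys_class[OF D reduce_extensional]
        step_val_reduce[OF C D ref] ..
  qed
  have "?represented B Y" if "equivclp ?id (A, sys_class U A f) (B, Y)"
    using that
  proof (induction "(B, Y)" arbitrary: B Y rule: equivclp_induct)
    case base
    show ?case
      using A f bool_rel_eq_refl[OF U step_val_boolean_element[OF U A]] by blast
  next
    case (step q B Y)
    then show ?case
      using id_represented by (cases q) metis
  qed
  moreover have "equivclp ?id (A, sys_class U A f) (B, Y)" if rep: "?represented B Y"
  proof -
    obtain g where B: "maximal_antichain B" and g: "g \<in> extensional B" "Y = sys_class U B g"
      and eq: "bool_rel (=) (step_val A f) (step_val B g) \<in> U"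
      using rep by blast
    obtain C where C: "maximal_antichain C" "refines C A" "refines C B"
      using common_refinement[OF A B] .
    have "sys_class U C (reduce A C f) = sys_class U C (reduce B C g)"
      using eq by (simp add: sys_class_eq_iff[OF U C(1) reduce_extensional reduce_extensional]
          step_val_reduce A B C)
    then have "?id (B, Y) (C, sys_class U C (reduce A C f))"
      using id[OF B C(1,3) g(1)] g(2) by simp
    then have "equivclp ?id (C, sys_class U C (reduce A C f)) (B, Y)"
      by (blast intro: r_into_equivclp equivclp_sym)
    then show ?thesis
      using id[OF A C(1,2) f] by (blast intro: r_into_equivclp equivclp_trans)
  qed
  ultimately show ?thesis
    unfolding sys_thread_def thread_def mem_Collect_eq by (rule iffI)
qed


section \<open>Boolean values of names\<close>

lemma bval_mem_upper: "(\<eta>, b) \<in> entries \<iota> \<sigma> \<Longrightarrow> bval_eq \<iota> \<tau> \<eta> \<sqinter> b \<le> bval_mem \<iota> \<tau> \<sigma>"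
  unfolding bval_mem.simps[of \<iota> \<tau> \<sigma>] by (intro SUP_upper2[of "(\<eta>, b)"]) auto

lemma bval_mem_inf_leI:
  assumes "\<And>\<eta> b. (\<eta>, b) \<in> entries \<iota> \<sigma> \<Longrightarrow> (bval_eq \<iota> \<tau> \<eta> \<sqinter> b) \<sqinter> a \<le> c"
  shows "bval_mem \<iota> \<tau> \<sigma> \<sqinter> a \<le> c"
  unfolding bval_mem.simps[of \<iota> \<tau> \<sigma>] by (rule SUP_inf_leI) (use assms in auto)

lemma bval_sub_inf_mem:
  assumes "\<eta> \<in> ndom \<iota> \<tau>"
  shows "bval_sub \<iota> \<tau> \<sigma> \<sqinter> bval_mem \<iota> \<eta> \<tau> \<le> bval_mem \<iota> \<eta> \<sigma>"
  unfolding shunt1 bval_sub.simps[of \<iota> \<tau> \<sigma>] using assms by (rule INF_lower)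

lemma le_bval_subI:
  assumes "\<And>\<eta>. \<eta> \<in> ndom \<iota> \<tau> \<Longrightarrow> a \<sqinter> bval_mem \<iota> \<eta> \<tau> \<le> bval_mem \<iota> \<eta> \<sigma>"
  shows "a \<le> bval_sub \<iota> \<tau> \<sigma>"
  using assms unfolding shunt1 bval_sub.simps[of \<iota> \<tau> \<sigma>] by (rule INF_greatest)

lemma bval_eq_refl: "bval_eq \<iota> \<tau> \<tau> = \<top>"
proof -
  have "\<top> \<le> bval_sub \<iota> \<tau> \<tau>"
    by (rule le_bval_subI) simp
  then show ?thesis
    by (simp add: bval_eq.simps top_unique)
qed

lemma bval_eq_sym: "bval_eq \<iota> \<tau> \<sigma> = bval_eq \<iota> \<sigma> \<tau>"
  by (simp add: bval_eq.simps inf_commute)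

lemma entries_le_bval_mem: "(\<eta>, b) \<in> entries \<iota> \<sigma> \<Longrightarrow> b \<le> bval_mem \<iota> \<eta> \<sigma>"
  using bval_mem_upper[of \<eta> b \<iota> \<sigma> \<eta>] by (simp add: bval_eq_refl)

lemma entries_in_ndom: "(\<eta>, b) \<in> entries \<iota> \<sigma> \<Longrightarrow> \<eta> \<in> ndom \<iota> \<sigma>"
  unfolding ndom_def by force

text \<open>
  Transitivity of equality at \<open>\<tau>\<close>, \<open>\<sigma>\<close>, \<open>\<rho>\<close> reduces to transitivity at members of their domains.
  The next three lemmas make this reduction, with the needed instances as hypotheses, and the
  induction is done in \<open>bval_eq_trans\<close>.
\<close>

lemma bval_mem_subst_left_step:
  assumes "\<And>\<eta>. \<eta> \<in> ndom \<iota> \<rho> \<Longrightarrow> bval_eq \<iota> \<tau> \<sigma> \<sqinter> bval_eq \<iota> \<sigma> \<eta> \<le> bval_eq \<iota> \<tau> \<eta>"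
  shows "bval_mem \<iota> \<sigma> \<rho> \<sqinter> bval_eq \<iota> \<tau> \<sigma> \<le> bval_mem \<iota> \<tau> \<rho>"
proof (rule bval_mem_inf_leI)
  fix \<eta> b assume \<eta>: "(\<eta>, b) \<in> entries \<iota> \<rho>"
  have "(bval_eq \<iota> \<sigma> \<eta> \<sqinter> b) \<sqinter> bval_eq \<iota> \<tau> \<sigma> = (bval_eq \<iota> \<tau> \<sigma> \<sqinter> bval_eq \<iota> \<sigma> \<eta>) \<sqinter> b"
    by (simp add: inf_commute inf_left_commute)
  also have "\<dots> \<le> bval_eq \<iota> \<tau> \<eta> \<sqinter> b"
    using assms[OF entries_in_ndom[OF \<eta>]] by (intro inf_mono order_refl)
  also have "\<dots> \<le> bval_mem \<iota> \<tau> \<rho>"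
    using \<eta> by (rule bval_mem_upper)
  finally show "(bval_eq \<iota> \<sigma> \<eta> \<sqinter> b) \<sqinter> bval_eq \<iota> \<tau> \<sigma> \<le> bval_mem \<iota> \<tau> \<rho>" .
qed

lemma bval_mem_sub_step:
  assumes trans: "\<And>\<zeta> \<xi>. \<zeta> \<in> ndom \<iota> \<sigma> \<Longrightarrow> \<xi> \<in> ndom \<iota> \<rho> \<Longrightarrow>
    bval_eq \<iota> \<eta> \<zeta> \<sqinter> bval_eq \<iota> \<zeta> \<xi> \<le> bval_eq \<iota> \<eta> \<xi>"
  shows "bval_mem \<iota> \<eta> \<sigma> \<sqinter> bval_sub \<iota> \<sigma> \<rho> \<le> bval_mem \<iota> \<eta> \<rho>"
proof (rule bval_mem_inf_leI)
  fix \<zeta> b assume \<zeta>: "(\<zeta>, b) \<in> entries \<iota> \<sigma>"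
  have "(bval_eq \<iota> \<eta> \<zeta> \<sqinter> b) \<sqinter> bval_sub \<iota> \<sigma> \<rho>
      \<le> (bval_sub \<iota> \<sigma> \<rho> \<sqinter> bval_mem \<iota> \<zeta> \<sigma>) \<sqinter> bval_eq \<iota> \<eta> \<zeta>"
    using entries_le_bval_mem[OF \<zeta>] by (simp add: le_infI1 le_infI2)
  also have "\<dots> \<le> bval_mem \<iota> \<zeta> \<rho> \<sqinter> bval_eq \<iota> \<eta> \<zeta>"
    using bval_sub_inf_mem[OF entries_in_ndom[OF \<zeta>]] by (intro inf_mono order_refl)
  also have "\<dots> \<le> bval_mem \<iota> \<eta> \<rho>"
    using trans[OF entries_in_ndom[OF \<zeta>]] by (rule bval_mem_subst_left_step)
  finally show "(bval_eq \<iota> \<eta> \<zeta> \<sqinter> b) \<sqinter> bval_sub \<iota> \<sigma> \<rho> \<le> bval_mem \<iota> \<eta> \<rho>" .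
qed

lemma bval_sub_trans_step:
  assumes "\<And>\<eta> \<zeta> \<xi>. \<eta> \<in> ndom \<iota> \<tau> \<Longrightarrow> \<zeta> \<in> ndom \<iota> \<sigma> \<Longrightarrow> \<xi> \<in> ndom \<iota> \<rho> \<Longrightarrow>
    bval_eq \<iota> \<eta> \<zeta> \<sqinter> bval_eq \<iota> \<zeta> \<xi> \<le> bval_eq \<iota> \<eta> \<xi>"
  shows "bval_sub \<iota> \<tau> \<sigma> \<sqinter> bval_sub \<iota> \<sigma> \<rho> \<le> bval_sub \<iota> \<tau> \<rho>"
proof (rule le_bval_subI)
  fix \<eta> assume \<eta>: "\<eta> \<in> ndom \<iota> \<tau>"
  have "(bval_sub \<iota> \<tau> \<sigma> \<sqinter> bval_sub \<iota> \<sigma> \<rho>) \<sqinter> bval_mem \<iota> \<eta> \<tau>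
      = (bval_sub \<iota> \<tau> \<sigma> \<sqinter> bval_mem \<iota> \<eta> \<tau>) \<sqinter> bval_sub \<iota> \<sigma> \<rho>"
    by (simp add: inf_commute inf_left_commute)
  also have "\<dots> \<le> bval_mem \<iota> \<eta> \<sigma> \<sqinter> bval_sub \<iota> \<sigma> \<rho>"
    using bval_sub_inf_mem[OF \<eta>] by (intro inf_mono order_refl)
  also have "\<dots> \<le> bval_mem \<iota> \<eta> \<rho>"
    using assms[OF \<eta>] by (rule bval_mem_sub_step)
  finally show "(bval_sub \<iota> \<tau> \<sigma> \<sqinter> bval_sub \<iota> \<sigma> \<rho>) \<sqinter> bval_mem \<iota> \<eta> \<tau> \<le> bval_mem \<iota> \<eta> \<rho>" .
qed

text \<open>
  Induction on \<open>\<rho>\<close> alone suffices: by symmetry of the equality, the inclusion of \<open>\<rho>\<close> in \<open>\<tau>\<close> needs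
  the same instances at the members of the domain of \<open>\<rho>\<close> as the inclusion of \<open>\<tau>\<close> in \<open>\<rho>\<close>.
\<close>

lemma bval_eq_trans: "bval_eq \<iota> \<tau> \<sigma> \<sqinter> bval_eq \<iota> \<sigma> \<rho> \<le> bval_eq \<iota> \<tau> \<rho>"
proof (induction \<rho> arbitrary: \<tau> \<sigma> rule: wf_induct_rule[OF wf_trancl[OF wf_elt_rel]])
  case (1 \<rho>)
  have trans: "bval_eq \<iota> \<eta> \<zeta> \<sqinter> bval_eq \<iota> \<zeta> \<xi> \<le> bval_eq \<iota> \<eta> \<xi>" if "\<xi> \<in> ndom \<iota> \<rho>" for \<eta> \<zeta> \<xi>
    using 1[OF ndom_below[OF that]] .
  then have trans': "bval_eq \<iota> \<xi> \<zeta> \<sqinter> bval_eq \<iota> \<zeta> \<eta> \<le> bval_eq \<iota> \<xi> \<eta>" if "\<xi> \<in> ndom \<iota> \<rho>" for \<eta> \<zeta> \<xi>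
    using that by (metis bval_eq_sym inf_commute)
  have "bval_sub \<iota> \<tau> \<sigma> \<sqinter> bval_sub \<iota> \<sigma> \<rho> \<le> bval_sub \<iota> \<tau> \<rho>"
    by (rule bval_sub_trans_step) (rule trans)
  moreover have "bval_sub \<iota> \<rho> \<sigma> \<sqinter> bval_sub \<iota> \<sigma> \<tau> \<le> bval_sub \<iota> \<rho> \<tau>"
    by (rule bval_sub_trans_step) (rule trans')
  ultimately have "(bval_sub \<iota> \<tau> \<sigma> \<sqinter> bval_sub \<iota> \<sigma> \<rho>) \<sqinter> (bval_sub \<iota> \<rho> \<sigma> \<sqinter> bval_sub \<iota> \<sigma> \<tau>)
      \<le> bval_sub \<iota> \<tau> \<rho> \<sqinter> bval_sub \<iota> \<rho> \<tau>"
    by (rule inf_mono)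
  moreover have "bval_eq \<iota> \<tau> \<sigma> \<sqinter> bval_eq \<iota> \<sigma> \<rho>
      = (bval_sub \<iota> \<tau> \<sigma> \<sqinter> bval_sub \<iota> \<sigma> \<rho>) \<sqinter> (bval_sub \<iota> \<rho> \<sigma> \<sqinter> bval_sub \<iota> \<sigma> \<tau>)"
    unfolding bval_eq.simps by (simp add: inf_assoc inf_commute inf_left_commute)
  ultimately show ?case
    by (simp add: bval_eq.simps[of \<iota> \<tau> \<rho>])
qed

lemma bval_mem_subst:
  "bval_mem \<iota> \<tau> \<sigma> \<sqinter> (bval_eq \<iota> \<tau> \<tau>' \<sqinter> bval_eq \<iota> \<sigma> \<sigma>') \<le> bval_mem \<iota> \<tau>' \<sigma>'"
proof -
  have "bval_mem \<iota> \<tau> \<sigma> \<sqinter> (bval_eq \<iota> \<tau> \<tau>' \<sqinter> bval_eq \<iota> \<sigma> \<sigma>')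
      \<le> (bval_mem \<iota> \<tau> \<sigma> \<sqinter> bval_eq \<iota> \<tau>' \<tau>) \<sqinter> bval_sub \<iota> \<sigma> \<sigma>'"
    by (simp add: bval_eq_sym[of \<iota> \<tau>'] bval_eq.simps[of \<iota> \<sigma>] le_infI1 le_infI2)
  also have "\<dots> \<le> bval_mem \<iota> \<tau>' \<sigma> \<sqinter> bval_sub \<iota> \<sigma> \<sigma>'"
    by (intro inf_mono order_refl bval_mem_subst_left_step bval_eq_trans)
  also have "\<dots> \<le> bval_mem \<iota> \<tau>' \<sigma>'"
    by (intro bval_mem_sub_step bval_eq_trans)
  finally show ?thesis .
qed

lemma bval_eq_subst:
  "bval_eq \<iota> \<tau> \<sigma> \<sqinter> (bval_eq \<iota> \<tau> \<tau>' \<sqinter> bval_eq \<iota> \<sigma> \<sigma>') \<le> bval_eq \<iota> \<tau>' \<sigma>'"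
proof -
  have "bval_eq \<iota> \<tau> \<sigma> \<sqinter> (bval_eq \<iota> \<tau> \<tau>' \<sqinter> bval_eq \<iota> \<sigma> \<sigma>')
      = (bval_eq \<iota> \<tau>' \<tau> \<sqinter> bval_eq \<iota> \<tau> \<sigma>) \<sqinter> bval_eq \<iota> \<sigma> \<sigma>'"
    by (simp add: bval_eq_sym[of \<iota> \<tau>'] inf_assoc inf_left_commute)
  also have "\<dots> \<le> bval_eq \<iota> \<tau>' \<sigma> \<sqinter> bval_eq \<iota> \<sigma> \<sigma>'"
    by (intro inf_mono order_refl bval_eq_trans)
  also have "\<dots> \<le> bval_eq \<iota> \<tau>' \<sigma>'"
    by (rule bval_eq_trans)
  finally show ?thesis .
qed


section \<open>Check names and ground names\<close>

lemma vpair_inject: "vpair x y = vpair x' y' \<longleftrightarrow> x = x' \<and> y = y'"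
proof
  assume "vpair x y = vpair x' y'"
  then have "{vset {x}, vset {x, y}} = {vset {x'}, vset {x', y'}}"
    by (metis elts_vpair)
  moreover have pair: "vset {a, b} = vset {c, d} \<longleftrightarrow> {a, b} = {c, d}" for a b c d :: 'a
    by (metis elts_vset_pair)
  moreover have "vset {a} = vset {c} \<longleftrightarrow> {a} = {c}" "vset {a} = vset {c, d} \<longleftrightarrow> {a} = {c, d}"
    "vset {c, d} = vset {a} \<longleftrightarrow> {c, d} = {a}" for a c d :: 'a
    using pair[of a a c c] pair[of a a c d] pair[of c d a a] by simp_all
  ultimately show "x = x' \<and> y = y'"
    by (auto simp: doubleton_eq_iff)
qed simp

lemma elts_check: "elts (check \<iota> x) = (\<lambda>y. vpair (check \<iota> y) (\<iota> \<top>)) ` elts x"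
  unfolding check.simps[of \<iota> x] by (intro elts_vset replacement)

lemma bname_check: "bname \<iota> (check \<iota> x)"
proof (induction x rule: wf_induct_rule[OF wf_elt_rel])
  case (1 x)
  then show ?case
    by (intro bname.intros) (auto simp: elts_check elt_rel_def)
qed

lemma entries_check: "inj \<iota> \<Longrightarrow> entries \<iota> (check \<iota> x) = (\<lambda>y. (check \<iota> y, \<top>)) ` elts x"
  by (auto simp: entries_def elts_check vpair_inject inj_eq)

lemma ndom_check: "inj \<iota> \<Longrightarrow> ndom \<iota> (check \<iota> x) = check \<iota> ` elts x"
  by (simp add: ndom_def entries_check image_image)

lemma bval_mem_check_right:
  "inj \<iota> \<Longrightarrow> bval_mem \<iota> \<tau> (check \<iota> x) = (\<Squnion>y\<in>elts x. bval_eq \<iota> \<tau> (check \<iota> y))"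
  by (simp add: bval_mem.simps[of \<iota> \<tau>] entries_check image_image)

text \<open>
  If \<open>x\<close> and \<open>y\<close> differ, then some \<open>z\<close> belongs to exactly one of them, and by induction
  \<open>\<lbrakk>z \<in> x\<rbrakk>\<close> and \<open>\<lbrakk>z \<in> y\<rbrakk>\<close> are \<open>\<top>\<close> and \<open>\<bottom>\<close> in one order.
\<close>

lemma bval_eq_check:
  assumes \<iota>: "inj \<iota>"
  shows "bval_eq \<iota> (check \<iota> x) (check \<iota> y) = (if x = y then \<top> else \<bottom>)"
proof (induction x arbitrary: y rule: wf_induct_rule[OF wf_elt_rel])
  case (1 x)
  have IH: "bval_eq \<iota> (check \<iota> z) (check \<iota> w) = (if z = w then \<top> else \<bottom>)"
      "bval_eq \<iota> (check \<iota> w) (check \<iota> z) = (if z = w then \<top> else \<bottom>)" if "z \<in> elts x" for z w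
    using 1[of z w] that by (simp_all add: elt_rel_def bval_eq_sym)
  have sub_bot: "bval_sub \<iota> (check \<iota> u) (check \<iota> v) = \<bottom>"
    if "z \<in> elts u" "bval_mem \<iota> (check \<iota> z) (check \<iota> v) = \<bottom>" for u v z
  proof -
    have "\<top> \<le> bval_mem \<iota> (check \<iota> z) (check \<iota> u)"
      using that(1) \<iota> by (intro entries_le_bval_mem) (simp add: entries_check)
    moreover have "bval_sub \<iota> (check \<iota> u) (check \<iota> v) \<sqinter> bval_mem \<iota> (check \<iota> z) (check \<iota> u) \<le> \<bottom>"
      using bval_sub_inf_mem[of "check \<iota> z" \<iota> "check \<iota> u" "check \<iota> v"] that \<iota>
      by (simp add: ndom_check)
    ultimately show ?thesis
      by (simp add: top_unique bot_unique)
  qed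
  show ?case
  proof (cases "x = y")
    case False
    then have "elts x \<noteq> elts y"
      using extensionality by blast
    then consider z where "z \<in> elts x" "z \<notin> elts y" | z where "z \<in> elts y" "z \<notin> elts x"
      by blast
    then have "bval_sub \<iota> (check \<iota> x) (check \<iota> y) = \<bottom> \<or> bval_sub \<iota> (check \<iota> y) (check \<iota> x) = \<bottom>"
    proof cases
      case 1
      then have "(if z = w then \<top> else \<bottom> :: 'a) = \<bottom>" if "w \<in> elts y" for w
        using that by auto
      then have "bval_mem \<iota> (check \<iota> z) (check \<iota> y) = \<bottom>"
        using IH(1)[OF 1(1)] by (simp add: bval_mem_check_right[OF \<iota>])
      then show ?thesis
        using 1(1) sub_bot by blast
    next
      case 2
      then have "(if w = z then \<top> else \<bottom> :: 'a) = \<bottom>" if "w \<in> elts x" for w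
        using that by auto
      then have "bval_mem \<iota> (check \<iota> z) (check \<iota> x) = \<bottom>"
        using IH(2) by (simp add: bval_mem_check_right[OF \<iota>])
      then show ?thesis
        using 2(1) sub_bot by blast
    qed
    then show ?thesis
      using False by (auto simp: bval_eq.simps)
  qed (simp add: bval_eq_refl)
qed

lemma bval_mem_check:
  assumes "inj \<iota>"
  shows "bval_mem \<iota> (check \<iota> x) (check \<iota> y) = (if x \<in> elts y then \<top> else \<bottom>)"
proof (cases "x \<in> elts y")
  case True
  then have "\<top> \<le> bval_mem \<iota> (check \<iota> x) (check \<iota> y)"
    using assms by (intro entries_le_bval_mem) (simp add: entries_check)
  then show ?thesis
    using True by (simp add: top_unique)
next
  case False
  then have "(if x = z then \<top> else \<bottom> :: 'a) = \<bottom>" if "z \<in> elts y" for z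
    using that by auto
  then show ?thesis
    using False by (simp add: bval_mem_check_right[OF assms] bval_eq_check[OF assms])
qed

definition ground_val ::
  "('b::{boolean_algebra, complete_lattice} \<Rightarrow> 'v::zfc_universe) \<Rightarrow> 'v \<Rightarrow> 'v \<Rightarrow> 'b" where
  "ground_val \<iota> \<tau> x = bval_eq \<iota> \<tau> (check \<iota> x)"

lemma ground_val_boolean_element:
  assumes "inj \<iota>" "bval_ground \<iota> \<tau> \<in> U"
  shows "boolean_element U (ground_val \<iota> \<tau>)"
  unfolding boolean_element_def
proof (intro conjI allI impI)
  fix x y :: 'b assume "x \<noteq> y"
  then show "ground_val \<iota> \<tau> x \<sqinter> ground_val \<iota> \<tau> y = \<bottom>"
    using bval_eq_trans[of \<iota> "check \<iota> x" \<tau> "check \<iota> y"]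
    by (simp add: ground_val_def bval_eq_check[OF assms(1)] bval_eq_sym[of \<iota> "check \<iota> x" \<tau>] bot_unique)
next
  show "(\<Squnion>x. ground_val \<iota> \<tau> x) \<in> U"
    using assms(2) by (simp add: bval_ground_def ground_val_def)
qed

lemma bval_ground_check: "bval_ground \<iota> (check \<iota> x) = \<top>"
proof -
  have "bval_eq \<iota> (check \<iota> x) (check \<iota> x) \<le> bval_ground \<iota> (check \<iota> x)"
    unfolding bval_ground_def by (rule SUP_upper) simp
  then show ?thesis
    by (simp add: bval_eq_refl top_unique)
qed

text \<open>
  Stated once for \<open>\<lbrakk>\<tau> = \<sigma>\<rbrakk>\<close> and \<open>\<lbrakk>\<tau> \<in> \<sigma>\<rbrakk>\<close>: a Boolean value \<open>v\<close> that respects equality of names is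
  determined on ground names by its values on check names.
\<close>

lemma bval_iff_bool_rel:
  assumes U: "ultrafilter U"
    and subst: "\<And>\<tau> \<sigma> \<tau>' \<sigma>'. v \<tau> \<sigma> \<sqinter> (bval_eq \<iota> \<tau> \<tau>' \<sqinter> bval_eq \<iota> \<sigma> \<sigma>') \<le> v \<tau>' \<sigma>'"
    and check: "\<And>x y. v (check \<iota> x) (check \<iota> y) = (if R x y then \<top> else \<bottom>)"
    and \<tau>: "bval_ground \<iota> \<tau> \<in> U" and \<sigma>: "bval_ground \<iota> \<sigma> \<in> U"
  shows "v \<tau> \<sigma> \<in> U \<longleftrightarrow> bool_rel R (ground_val \<iota> \<tau>) (ground_val \<iota> \<sigma>) \<in> U"
proof
  assume v: "v \<tau> \<sigma> \<in> U"
  have "bval_ground \<iota> \<tau> \<sqinter> bval_ground \<iota> \<sigma>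
      \<le> - v \<tau> \<sigma> \<squnion> bool_rel R (ground_val \<iota> \<tau>) (ground_val \<iota> \<sigma>)"
    unfolding bval_ground_def
  proof (rule SUP_inf_SUP_leI)
    fix x y
    let ?e = "bval_eq \<iota> \<tau> (check \<iota> x) \<sqinter> bval_eq \<iota> \<sigma> (check \<iota> y)"
    have "?e \<sqinter> v \<tau> \<sigma> \<le> bool_rel R (ground_val \<iota> \<tau>) (ground_val \<iota> \<sigma>)"
    proof (cases "R x y")
      case True
      have "?e \<sqinter> v \<tau> \<sigma> \<le> ground_val \<iota> \<tau> x \<sqinter> ground_val \<iota> \<sigma> y"
        unfolding ground_val_def by (rule inf_le1)
      also have "\<dots> \<le> bool_rel R (ground_val \<iota> \<tau>) (ground_val \<iota> \<sigma>)"
        using True by (rule bool_rel_upper)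
      finally show ?thesis .
    next
      case False
      have "v \<tau> \<sigma> \<sqinter> ?e \<le> \<bottom>"
        using subst[of \<tau> \<sigma> "check \<iota> x" "check \<iota> y"] False by (simp only: check if_False)
      then have "?e \<sqinter> v \<tau> \<sigma> \<le> \<bottom>"
        by (simp only: inf_commute)
      then show ?thesis
        by (rule order_trans) simp
    qed
    then show "?e \<le> - v \<tau> \<sigma> \<squnion> bool_rel R (ground_val \<iota> \<tau>) (ground_val \<iota> \<sigma>)"
      by (simp only: shunt1)
  qed
  then have "(bval_ground \<iota> \<tau> \<sqinter> bval_ground \<iota> \<sigma>) \<sqinter> v \<tau> \<sigma>
      \<le> bool_rel R (ground_val \<iota> \<tau>) (ground_val \<iota> \<sigma>)"
    by (simp only: shunt1)
  moreover have "(bval_ground \<iota> \<tau> \<sqinter> bval_ground \<iota> \<sigma>) \<sqinter> v \<tau> \<sigma> \<in> U"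
    using v \<tau> \<sigma> by (intro ultrafilter_inf[OF U])
  ultimately show "bool_rel R (ground_val \<iota> \<tau>) (ground_val \<iota> \<sigma>) \<in> U"
    using ultrafilter_upward[OF U] by blast
next
  have "bool_rel R (ground_val \<iota> \<tau>) (ground_val \<iota> \<sigma>) \<le> v \<tau> \<sigma>"
  proof (rule bool_rel_least)
    fix x y assume "R x y"
    then show "ground_val \<iota> \<tau> x \<sqinter> ground_val \<iota> \<sigma> y \<le> v \<tau> \<sigma>"
      using subst[of "check \<iota> x" "check \<iota> y" \<tau> \<sigma>]
      by (simp add: check ground_val_def bval_eq_sym[of \<iota> \<tau> "check \<iota> x"]
        bval_eq_sym[of \<iota> \<sigma> "check \<iota> y"])
  qed
  then show "bool_rel R (ground_val \<iota> \<tau>) (ground_val \<iota> \<sigma>) \<in> U \<Longrightarrow> v \<tau> \<sigma> \<in> U"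
    using ultrafilter_upward[OF U] by blast
qed

lemma bval_eq_iff_bool_rel:
  assumes "ultrafilter U" "inj \<iota>" "bval_ground \<iota> \<tau> \<in> U" "bval_ground \<iota> \<sigma> \<in> U"
  shows "bval_eq \<iota> \<tau> \<sigma> \<in> U \<longleftrightarrow> bool_rel (=) (ground_val \<iota> \<tau>) (ground_val \<iota> \<sigma>) \<in> U"
  using assms(1) bval_eq_subst bval_eq_check[OF assms(2)] assms(3,4) by (rule bval_iff_bool_rel)

lemma bval_mem_iff_bool_rel:
  assumes "ultrafilter U" "inj \<iota>" "bval_ground \<iota> \<tau> \<in> U" "bval_ground \<iota> \<sigma> \<in> U"
  shows "bval_mem \<iota> \<tau> \<sigma> \<in> U \<longleftrightarrow>
    bool_rel (\<lambda>x y. x \<in> elts y) (ground_val \<iota> \<tau>) (ground_val \<iota> \<sigma>) \<in> U"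
  using assms(1) bval_mem_subst bval_mem_check[OF assms(2)] assms(3,4) by (rule bval_iff_bool_rel)

text \<open>Embedded elements of \<open>V\<close> have the same Boolean-valued element on both sides.\<close>

lemma ground_val_check:
  fixes \<iota> :: "'b::{boolean_algebra, complete_lattice} \<Rightarrow> 'v::zfc_universe"
  assumes \<iota>: "inj \<iota>" and A: "maximal_antichain A"
  shows "ground_val \<iota> (check \<iota> x) = step_val A (\<lambda>a\<in>A. x)"
proof
  fix y
  have "{a \<in> A. (\<lambda>a\<in>A. x) a = y} = (if x = y then A else {})"
    by auto
  then show "ground_val \<iota> (check \<iota> x) y = step_val A (\<lambda>a\<in>A. x) y"
    using A by (simp add: ground_val_def step_val_def bval_eq_check[OF \<iota>] maximal_antichain_iff)
qed

text \<open>Unions indexed by the algebra are sets, because the algebra is one.\<close>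

lemma ex_elts_UN:
  fixes \<iota> :: "'b \<Rightarrow> 'v::zfc_universe" and S :: "'b \<Rightarrow> 'v set"
  assumes \<iota>: "embeds_as_set \<iota>" and S: "\<And>b. \<exists>z. elts z = S b"
  shows "\<exists>z. elts z = (\<Union>b. S b)"
proof -
  obtain B where B: "elts B = range \<iota>" and inj: "inj \<iota>"
    using \<iota> unfolding embeds_as_set_def by blast
  obtain s where s: "\<And>b. elts (s b) = S b"
    using S by metis
  obtain W where "elts W = (\<lambda>c. s (inv \<iota> c)) ` elts B"
    using replacement[where f = "\<lambda>c. s (inv \<iota> c)" and x = B] by (rule exE)
  then have "elts W = range s"
    using inj by (simp add: B image_image)
  then show ?thesis
    using union[of W] s by simp
qed

text \<open>
  Mixing: the name puts \<open>check y\<close> in with value \<open>a\<close> whenever \<open>y \<in> f a\<close>.  Below \<open>a\<close> all other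
  entries vanish, so that \<open>a\<close> forces the name to be equal to \<open>check (f a)\<close>.
\<close>

lemma ex_mixed_name:
  fixes \<iota> :: "'b::{boolean_algebra, complete_lattice} \<Rightarrow> 'v::zfc_universe"
  assumes U: "ultrafilter U" and \<iota>: "embeds_as_set \<iota>" and A: "maximal_antichain A"
  obtains \<tau> where "bname \<iota> \<tau>" "bval_ground \<iota> \<tau> \<in> U"
    "bool_rel (=) (ground_val \<iota> \<tau>) (step_val A f) \<in> U"
proof -
  have inj: "inj \<iota>" and anti: "antichain A" and top: "\<Squnion>A = \<top>"
    using \<iota> A by (simp_all add: embeds_as_set_def maximal_antichain_iff)
  have "\<exists>z. elts z = {p \<in> (\<lambda>y. vpair (check \<iota> y) (\<iota> a)) ` elts (f a). a \<in> A}" for a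
  proof -
    obtain w where "elts w = (\<lambda>y. vpair (check \<iota> y) (\<iota> a)) ` elts (f a)"
      using replacement[where f = "\<lambda>y. vpair (check \<iota> y) (\<iota> a)" and x = "f a"] by (rule exE)
    then show ?thesis
      using separation[of w "\<lambda>_. a \<in> A"] by simp
  qed
  then obtain \<tau>
    where \<tau>: "elts \<tau> = (\<Union>a. {p \<in> (\<lambda>y. vpair (check \<iota> y) (\<iota> a)) ` elts (f a). a \<in> A})"
    by (rule ex_elts_UN[OF \<iota>, THEN exE])
  have "bname \<iota> \<tau>"
    by (rule bname.intros) (auto simp: \<tau> bname_check)
  have entries: "entries \<iota> \<tau> = {(check \<iota> y, a) | y a. a \<in> A \<and> y \<in> elts (f a)}"
    by (auto simp: entries_def \<tau> vpair_inject inj_eq[OF inj])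
  have below: "a \<le> bval_eq \<iota> \<tau> (check \<iota> (f a))" if a: "a \<in> A" for a
    unfolding bval_eq.simps[of \<iota> \<tau>]
  proof (intro inf_greatest le_bval_subI)
    fix \<eta> assume "\<eta> \<in> ndom \<iota> \<tau>"
    then obtain y where \<eta>: "\<eta> = check \<iota> y"
      by (auto simp: ndom_def entries)
    have "bval_mem \<iota> \<eta> \<tau> \<sqinter> a \<le> bval_mem \<iota> \<eta> (check \<iota> (f a))"
    proof (cases "y \<in> elts (f a)")
      case True
      then show ?thesis
        by (simp add: \<eta> bval_mem_check[OF inj])
    next
      case False
      show ?thesis
      proof (rule bval_mem_inf_leI)
        fix \<zeta> c assume "(\<zeta>, c) \<in> entries \<iota> \<tau>"
        then obtain z where z: "\<zeta> = check \<iota> z" "c \<in> A" "z \<in> elts (f c)"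
          by (auto simp: entries)
        have "bval_eq \<iota> \<eta> \<zeta> = \<bottom> \<or> c \<sqinter> a = \<bottom>"
          using False z antichain_disjoint[OF anti z(2) a]
          by (cases "c = a") (auto simp: \<eta> bval_eq_check[OF inj])
        then show "(bval_eq \<iota> \<eta> \<zeta> \<sqinter> c) \<sqinter> a \<le> bval_mem \<iota> \<eta> (check \<iota> (f a))"
          by (auto simp: inf_assoc)
      qed
    qed
    then show "a \<sqinter> bval_mem \<iota> \<eta> \<tau> \<le> bval_mem \<iota> \<eta> (check \<iota> (f a))"
      by (simp only: inf_commute)
  next
    fix \<eta> assume "\<eta> \<in> ndom \<iota> (check \<iota> (f a))"
    then obtain y where "\<eta> = check \<iota> y" "y \<in> elts (f a)"
      by (auto simp: ndom_check[OF inj])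
    then have "a \<le> bval_mem \<iota> \<eta> \<tau>"
      using a by (intro entries_le_bval_mem) (auto simp: entries)
    then show "a \<sqinter> bval_mem \<iota> \<eta> (check \<iota> (f a)) \<le> bval_mem \<iota> \<eta> \<tau>"
      by (rule le_infI1)
  qed
  have "a \<le> bval_ground \<iota> \<tau>" if "a \<in> A" for a
    unfolding bval_ground_def using below[OF that] by (intro SUP_upper2) auto
  then have "\<Squnion>A \<le> bval_ground \<iota> \<tau>"
    by (rule Sup_least)
  moreover have "a \<le> bool_rel (=) (ground_val \<iota> \<tau>) (step_val A f)" if "a \<in> A" for a
  proof -
    have "a \<le> ground_val \<iota> \<tau> (f a) \<sqinter> step_val A f (f a)"
      using below[OF that] step_val_upper[OF that, of f] by (simp add: ground_val_def)
    also have "\<dots> \<le> bool_rel (=) (ground_val \<iota> \<tau>) (step_val A f)"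
      by (rule bool_rel_upper) (rule refl)
    finally show ?thesis .
  qed
  then have "\<Squnion>A \<le> bool_rel (=) (ground_val \<iota> \<tau>) (step_val A f)"
    by (rule Sup_least)
  ultimately show thesis
    using \<open>bname \<iota> \<tau>\<close> that ultrafilter_top[OF U] by (simp add: top top_unique)
qed


section \<open>The isomorphism\<close>

lemma mem_bclassD: "\<sigma> \<in> bclass \<iota> U \<tau> \<Longrightarrow> bname \<iota> \<sigma>" "\<sigma> \<in> bclass \<iota> U \<tau> \<Longrightarrow> bval_eq \<iota> \<tau> \<sigma> \<in> U"
  by (simp_all add: bclass_def full_class_def)

lemma bclass_nonempty:
  assumes "ultrafilter U" "bname \<iota> \<tau>"
  obtains \<sigma> where "\<sigma> \<in> bclass \<iota> U \<tau>"
proof -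
  have "\<tau> \<in> full_class \<iota> U \<tau>"
    using assms by (simp add: full_class_def bval_eq_refl ultrafilter_top)
  then obtain \<sigma> where "\<sigma> \<in> full_class \<iota> U \<tau>"
    "\<And>\<rho>. (\<rho>, \<sigma>) \<in> inv_image elt_rel rank \<Longrightarrow> \<rho> \<notin> full_class \<iota> U \<tau>"
    using wfE_min[OF wf_inv_image[OF wf_elt_rel]] by metis
  then have "\<sigma> \<in> bclass \<iota> U \<tau>"
    by (auto simp: bclass_def elt_rel_def)
  then show thesis
    by (rule that)
qed

lemma bclass_eq_iff:
  assumes U: "ultrafilter U" and "bname \<iota> \<tau>"
  shows "bclass \<iota> U \<tau> = bclass \<iota> U \<sigma> \<longleftrightarrow> bval_eq \<iota> \<tau> \<sigma> \<in> U"
proof -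
  have trans: "bval_eq \<iota> \<tau> \<rho> \<in> U" if "bval_eq \<iota> \<tau> \<sigma> \<in> U" "bval_eq \<iota> \<sigma> \<rho> \<in> U" for \<tau> \<sigma> \<rho>
    using that ultrafilter_inf[OF U] ultrafilter_upward[OF U] bval_eq_trans by blast
  show ?thesis
  proof
    assume eq: "bclass \<iota> U \<tau> = bclass \<iota> U \<sigma>"
    obtain \<rho> where "\<rho> \<in> bclass \<iota> U \<tau>"
      using bclass_nonempty[OF assms] .
    then have "bval_eq \<iota> \<tau> \<rho> \<in> U" "bval_eq \<iota> \<rho> \<sigma> \<in> U"
      using eq mem_bclassD(2) bval_eq_sym by metis+
    then show "bval_eq \<iota> \<tau> \<sigma> \<in> U"
      by (rule trans)
  next
    assume eq: "bval_eq \<iota> \<tau> \<sigma> \<in> U"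
    then have "bval_eq \<iota> \<sigma> \<tau> \<in> U"
      by (simp only: bval_eq_sym)
    then have "full_class \<iota> U \<tau> = full_class \<iota> U \<sigma>"
      unfolding full_class_def using eq trans by blast
    then show "bclass \<iota> U \<tau> = bclass \<iota> U \<sigma>"
      by (simp add: bclass_def)
  qed
qed

lemma bval_ground_mem_bclass:
  assumes U: "ultrafilter U" and \<tau>: "bval_ground \<iota> \<tau> \<in> U" and \<rho>: "\<rho> \<in> bclass \<iota> U \<tau>"
  shows "bval_ground \<iota> \<rho> \<in> U"
proof -
  have "bval_ground \<iota> \<tau> \<sqinter> bval_eq \<iota> \<tau> \<rho> \<le> bval_ground \<iota> \<rho>"
    unfolding bval_ground_def[of \<iota> \<tau>]
  proof (rule SUP_inf_leI)
    fix x
    have "bval_eq \<iota> \<tau> (check \<iota> x) \<sqinter> bval_eq \<iota> \<tau> \<rho> \<le> bval_eq \<iota> \<rho> (check \<iota> x)"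
      using bval_eq_trans[of \<iota> \<rho> \<tau> "check \<iota> x"] by (simp add: bval_eq_sym[of \<iota> \<rho> \<tau>] inf_commute)
    also have "\<dots> \<le> bval_ground \<iota> \<rho>"
      unfolding bval_ground_def by (rule SUP_upper) simp
    finally show "bval_eq \<iota> \<tau> (check \<iota> x) \<sqinter> bval_eq \<iota> \<tau> \<rho> \<le> bval_ground \<iota> \<rho>" .
  qed
  then show ?thesis
    using ultrafilter_upward[OF U] ultrafilter_inf[OF U \<tau> mem_bclassD(2)[OF \<rho>]] by blast
qed

lemma boolean_ultrapower_mem_iff:
  assumes U: "ultrafilter U" and "bname \<iota> \<tau>" "bname \<iota> \<sigma>"
  shows "boolean_ultrapower_mem \<iota> U (bclass \<iota> U \<tau>) (bclass \<iota> U \<sigma>) \<longleftrightarrow> bval_mem \<iota> \<tau> \<sigma> \<in> U"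
proof -
  have subst: "bval_mem \<iota> \<tau> \<sigma> \<in> U"
    if "bval_mem \<iota> \<tau>' \<sigma>' \<in> U" "bval_eq \<iota> \<tau>' \<tau> \<in> U" "bval_eq \<iota> \<sigma>' \<sigma> \<in> U" for \<tau> \<sigma> \<tau>' \<sigma>'
    using ultrafilter_upward[OF U ultrafilter_inf[OF U that(1) ultrafilter_inf[OF U that(2,3)]]]
      bval_mem_subst by blast
  obtain \<tau>' \<sigma>' where \<tau>': "\<tau>' \<in> bclass \<iota> U \<tau>" and \<sigma>': "\<sigma>' \<in> bclass \<iota> U \<sigma>"
    using assms bclass_nonempty by metis
  show ?thesis
  proof
    assume "boolean_ultrapower_mem \<iota> U (bclass \<iota> U \<tau>) (bclass \<iota> U \<sigma>)"
    then show "bval_mem \<iota> \<tau> \<sigma> \<in> U"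
      unfolding boolean_ultrapower_mem_def using subst mem_bclassD(2) bval_eq_sym by metis
  next
    assume "bval_mem \<iota> \<tau> \<sigma> \<in> U"
    then have "bval_mem \<iota> \<tau>' \<sigma>' \<in> U"
      using subst mem_bclassD(2)[OF \<tau>'] mem_bclassD(2)[OF \<sigma>'] by blast
    then show "boolean_ultrapower_mem \<iota> U (bclass \<iota> U \<tau>) (bclass \<iota> U \<sigma>)"
      unfolding boolean_ultrapower_mem_def using \<tau>' \<sigma>' by blast
  qed
qed

text \<open>
  The isomorphism is defined by its graph and without choices, so that a class of names is sent
  to the set of all its representations in the directed system.
\<close>

definition limit_iso ::
  "('b::{boolean_algebra, complete_lattice} \<Rightarrow> 'v::zfc_universe) \<Rightarrow> 'b set \<Rightarrow> 'v set \<Rightarrow>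
   ('b set \<times> ('b \<Rightarrow> 'v) set) set" where
  "limit_iso \<iota> U X = {(B, sys_class U B g) | B g. maximal_antichain B \<and> g \<in> extensional B \<and>
     (\<exists>\<tau>\<in>X. bool_rel (=) (ground_val \<iota> \<tau>) (step_val B g) \<in> U)}"

lemma mem_limit_iso_iff:
  assumes U: "ultrafilter U" and \<iota>: "inj \<iota>"
    and \<tau>: "bname \<iota> \<tau>" "bval_ground \<iota> \<tau> \<in> U"
  shows "(B, Y) \<in> limit_iso \<iota> U (bclass \<iota> U \<tau>) \<longleftrightarrow>
    maximal_antichain B \<and> (\<exists>g\<in>extensional B. Y = sys_class U B g \<and>
      bool_rel (=) (ground_val \<iota> \<tau>) (step_val B g) \<in> U)"
proof -
  have rep: "bool_rel (=) (ground_val \<iota> \<rho>) \<psi> \<in> U \<longleftrightarrow> bool_rel (=) (ground_val \<iota> \<tau>) \<psi> \<in> U"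
    if \<rho>: "\<rho> \<in> bclass \<iota> U \<tau>" for \<rho> \<psi>
  proof -
    have \<rho>': "bval_ground \<iota> \<rho> \<in> U"
      using bval_ground_mem_bclass[OF U \<tau>(2) \<rho>] .
    have eq: "bool_rel (=) (ground_val \<iota> \<tau>) (ground_val \<iota> \<rho>) \<in> U"
      using mem_bclassD(2)[OF \<rho>] bval_eq_iff_bool_rel[OF U \<iota> \<tau>(2) \<rho>'] by simp
    then have "bool_rel (=) (ground_val \<iota> \<rho>) (ground_val \<iota> \<tau>) \<in> U"
      by (simp only: bool_rel_eq_sym)
    then show ?thesis
      using eq bool_rel_eq_trans[OF U] ground_val_boolean_element[OF \<iota> \<tau>(2)]
        ground_val_boolean_element[OF \<iota> \<rho>'] by blast
  qed
  obtain \<rho> where "\<rho> \<in> bclass \<iota> U \<tau>"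
    using bclass_nonempty[OF U \<tau>(1)] .
  then show ?thesis
    unfolding limit_iso_def using rep by blast
qed

text \<open>
  Both sides collect the functions whose element is equivalent to that of \<open>\<tau>\<close>, respectively of \<open>f\<close>.
\<close>

lemma limit_iso_eq_thread:
  assumes U: "ultrafilter U" and \<iota>: "inj \<iota>"
    and \<tau>: "bname \<iota> \<tau>" "bval_ground \<iota> \<tau> \<in> U"
    and A: "maximal_antichain A" and f: "f \<in> extensional A"
    and eq: "bool_rel (=) (ground_val \<iota> \<tau>) (step_val A f) \<in> U"
  shows "limit_iso \<iota> U (bclass \<iota> U \<tau>) = sys_thread U A (sys_class U A f)"
proof -
  have \<tau>_elem: "boolean_element U (ground_val \<iota> \<tau>)"
    using \<iota> \<tau>(2) by (rule ground_val_boolean_element)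
  have f_elem: "boolean_element U (step_val A f)"
    using U A by (rule step_val_boolean_element)
  have eq': "bool_rel (=) (step_val A f) (ground_val \<iota> \<tau>) \<in> U"
    using eq by (simp only: bool_rel_eq_sym)
  have "bool_rel (=) (ground_val \<iota> \<tau>) \<psi> \<in> U \<longleftrightarrow> bool_rel (=) (step_val A f) \<psi> \<in> U" for \<psi>
    using eq eq' bool_rel_eq_trans[OF U] \<tau>_elem f_elem by blast
  then show ?thesis
    by (simp add: set_eq_iff mem_limit_iso_iff[OF U \<iota> \<tau>] mem_sys_thread_iff[OF U A f])
qed

lemma limit_iso_mem_iff:
  assumes U: "ultrafilter U" and \<iota>: "inj \<iota>"
    and \<tau>: "bname \<iota> \<tau>" "bval_ground \<iota> \<tau> \<in> U" and \<sigma>: "bname \<iota> \<sigma>" "bval_ground \<iota> \<sigma> \<in> U"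
  shows "sys_limit_mem U (limit_iso \<iota> U (bclass \<iota> U \<tau>)) (limit_iso \<iota> U (bclass \<iota> U \<sigma>)) \<longleftrightarrow>
    bval_mem \<iota> \<tau> \<sigma> \<in> U"
proof -
  have \<tau>_elem: "boolean_element U (ground_val \<iota> \<tau>)" and \<sigma>_elem: "boolean_element U (ground_val \<iota> \<sigma>)"
    using \<iota> \<tau>(2) \<sigma>(2) by (simp_all add: ground_val_boolean_element)
  have sys_mem_iff: "sys_mem U C (sys_class U C f) (sys_class U C g) \<longleftrightarrow> bval_mem \<iota> \<tau> \<sigma> \<in> U"
    if C: "maximal_antichain C" and f: "f \<in> extensional C" and g: "g \<in> extensional C"
      and eqs: "bool_rel (=) (ground_val \<iota> \<tau>) (step_val C f) \<in> U"
        "bool_rel (=) (ground_val \<iota> \<sigma>) (step_val C g) \<in> U" for C f g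
    unfolding sys_mem_sys_class[OF U C f g] bval_mem_iff_bool_rel[OF U \<iota> \<tau>(2) \<sigma>(2)]
    using bool_rel_cong_iff[OF U \<tau>_elem \<sigma>_elem step_val_boolean_element[OF U C]
        step_val_boolean_element[OF U C] eqs] by simp
  show ?thesis
  proof
    assume "sys_limit_mem U (limit_iso \<iota> U (bclass \<iota> U \<tau>)) (limit_iso \<iota> U (bclass \<iota> U \<sigma>))"
    then show "bval_mem \<iota> \<tau> \<sigma> \<in> U"
      unfolding sys_limit_mem_def direct_limit_rel_def mem_limit_iso_iff[OF U \<iota> \<tau>]
        mem_limit_iso_iff[OF U \<iota> \<sigma>]
      using sys_mem_iff by blast
  next
    assume mem: "bval_mem \<iota> \<tau> \<sigma> \<in> U"
    \<comment> \<open>Membership in the limit is witnessed over a single antichain, so the two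
      representing functions are moved to a common refinement.\<close>
    obtain A f where A: "maximal_antichain A" and f: "f \<in> extensional A"
      and \<tau>f: "bool_rel (=) (ground_val \<iota> \<tau>) (step_val A f) \<in> U"
      using ex_step_val[OF U \<tau>_elem] .
    obtain B g where B: "maximal_antichain B" and g: "g \<in> extensional B"
      and \<sigma>g: "bool_rel (=) (ground_val \<iota> \<sigma>) (step_val B g) \<in> U"
      using ex_step_val[OF U \<sigma>_elem] .
    obtain C where C: "maximal_antichain C" and CA: "refines C A" and CB: "refines C B"
      using common_refinement[OF A B] .
    have \<tau>C: "bool_rel (=) (ground_val \<iota> \<tau>) (step_val C (reduce A C f)) \<in> U"
      using \<tau>f by (simp add: step_val_reduce[OF A C CA])
    have \<sigma>C: "bool_rel (=) (ground_val \<iota> \<sigma>) (step_val C (reduce B C g)) \<in> U"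
      using \<sigma>g by (simp add: step_val_reduce[OF B C CB])
    have "sys_mem U C (sys_class U C (reduce A C f)) (sys_class U C (reduce B C g))"
      using sys_mem_iff[OF C reduce_extensional reduce_extensional \<tau>C \<sigma>C] mem by simp
    moreover have "(C, sys_class U C (reduce A C f)) \<in> limit_iso \<iota> U (bclass \<iota> U \<tau>)"
      unfolding mem_limit_iso_iff[OF U \<iota> \<tau>] using C \<tau>C reduce_extensional by blast
    moreover have "(C, sys_class U C (reduce B C g)) \<in> limit_iso \<iota> U (bclass \<iota> U \<sigma>)"
      unfolding mem_limit_iso_iff[OF U \<iota> \<sigma>] using C \<sigma>C reduce_extensional by blast
    ultimately show "sys_limit_mem U (limit_iso \<iota> U (bclass \<iota> U \<tau>)) (limit_iso \<iota> U (bclass \<iota> U \<sigma>))"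
      unfolding sys_limit_mem_def direct_limit_rel_def by blast
  qed
qed

lemma limit_iso_bij_betw:
  fixes \<iota> :: "'b::{boolean_algebra, complete_lattice} \<Rightarrow> 'v::zfc_universe"
  assumes U: "ultrafilter U" and \<iota>: "embeds_as_set \<iota>"
  shows "bij_betw (limit_iso \<iota> U) (boolean_ultrapower \<iota> U) (sys_limit U)"
proof (rule bij_betwI')
  have inj: "inj \<iota>"
    using \<iota> by (simp add: embeds_as_set_def)
  {
    fix X Y assume "X \<in> boolean_ultrapower \<iota> U" "Y \<in> boolean_ultrapower \<iota> U"
    then obtain \<tau> \<sigma> where X: "X = bclass \<iota> U \<tau>" and \<tau>: "bname \<iota> \<tau>" "bval_ground \<iota> \<tau> \<in> U"
      and Y: "Y = bclass \<iota> U \<sigma>" and \<sigma>: "bname \<iota> \<sigma>" "bval_ground \<iota> \<sigma> \<in> U"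
      unfolding boolean_ultrapower_def by blast
    have \<tau>_elem: "boolean_element U (ground_val \<iota> \<tau>)" and \<sigma>_elem: "boolean_element U (ground_val \<iota> \<sigma>)"
      using inj \<tau>(2) \<sigma>(2) by (simp_all add: ground_val_boolean_element)
    show "limit_iso \<iota> U X = limit_iso \<iota> U Y \<longleftrightarrow> X = Y"
    proof
      assume eq: "limit_iso \<iota> U X = limit_iso \<iota> U Y"
      obtain A f where A: "maximal_antichain A" and f: "f \<in> extensional A"
        and \<tau>f: "bool_rel (=) (ground_val \<iota> \<tau>) (step_val A f) \<in> U"
        using ex_step_val[OF U \<tau>_elem] .
      have "(A, sys_class U A f) \<in> limit_iso \<iota> U (bclass \<iota> U \<tau>)"
        unfolding mem_limit_iso_iff[OF U inj \<tau>] using A f \<tau>f by blast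
      then have "(A, sys_class U A f) \<in> limit_iso \<iota> U (bclass \<iota> U \<sigma>)"
        using eq X Y by simp
      then obtain g where "g \<in> extensional A" "sys_class U A f = sys_class U A g"
        and \<sigma>g: "bool_rel (=) (ground_val \<iota> \<sigma>) (step_val A g) \<in> U"
        unfolding mem_limit_iso_iff[OF U inj \<sigma>] by blast
      then have fg: "bool_rel (=) (step_val A f) (step_val A g) \<in> U"
        using sys_class_eq_iff[OF U A f] by blast
      have g\<sigma>: "bool_rel (=) (step_val A g) (ground_val \<iota> \<sigma>) \<in> U"
        using \<sigma>g by (simp only: bool_rel_eq_sym)
      have "bool_rel (=) (ground_val \<iota> \<tau>) (step_val A g) \<in> U"
        using U \<tau>_elem step_val_boolean_element[OF U A] \<tau>f fg by (rule bool_rel_eq_trans)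
      then have "bool_rel (=) (ground_val \<iota> \<tau>) (ground_val \<iota> \<sigma>) \<in> U"
        using bool_rel_eq_trans[OF U \<tau>_elem step_val_boolean_element[OF U A]] g\<sigma> by blast
      then show "X = Y"
        unfolding X Y bclass_eq_iff[OF U \<tau>(1)] bval_eq_iff_bool_rel[OF U inj \<tau>(2) \<sigma>(2)] .
    qed simp
  }
  {
    fix X assume "X \<in> boolean_ultrapower \<iota> U"
    then obtain \<tau> where X: "X = bclass \<iota> U \<tau>" and \<tau>: "bname \<iota> \<tau>" "bval_ground \<iota> \<tau> \<in> U"
      unfolding boolean_ultrapower_def by blast
    obtain A f where A: "maximal_antichain A" and f: "f \<in> extensional A"
      and \<tau>f: "bool_rel (=) (ground_val \<iota> \<tau>) (step_val A f) \<in> U"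
      using ex_step_val[OF U ground_val_boolean_element[OF inj \<tau>(2)]] .
    show "limit_iso \<iota> U X \<in> sys_limit U"
      unfolding X limit_iso_eq_thread[OF U inj \<tau> A f \<tau>f]
      unfolding sys_limit_def direct_limit_def sys_thread_def
      using A f by (auto simp: sys_model_def ultrapower_def)
  }
  {
    fix T :: "('b set \<times> ('b \<Rightarrow> 'v) set) set" assume "T \<in> sys_limit U"
    then obtain A f where A: "maximal_antichain A" and f: "f \<in> extensional A"
      and T: "T = sys_thread U A (sys_class U A f)"
      by (auto simp: sys_limit_def direct_limit_def sys_thread_def sys_model_def ultrapower_def)
    obtain \<tau> where \<tau>: "bname \<iota> \<tau>" "bval_ground \<iota> \<tau> \<in> U"
      and \<tau>f: "bool_rel (=) (ground_val \<iota> \<tau>) (step_val A f) \<in> U"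
      using ex_mixed_name[OF U \<iota> A] .
    have "T = limit_iso \<iota> U (bclass \<iota> U \<tau>)"
      unfolding T limit_iso_eq_thread[OF U inj \<tau> A f \<tau>f] ..
    then show "\<exists>X\<in>boolean_ultrapower \<iota> U. T = limit_iso \<iota> U X"
      unfolding boolean_ultrapower_def using \<tau> by blast
  }
qed

theorem theorem36:
  fixes U :: "'b::{boolean_algebra, complete_lattice} set"
    and \<iota> :: "'b \<Rightarrow> 'v::zfc_universe"
  assumes "embeds_as_set \<iota>"
    and "ultrafilter U"
  shows "\<exists>h. bij_betw h (boolean_ultrapower \<iota> U) (sys_limit U :: ('b set \<times> ('b \<Rightarrow> 'v) set) set set) \<and>
             (\<forall>X\<in>boolean_ultrapower \<iota> U. \<forall>Y\<in>boolean_ultrapower \<iota> U.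
                boolean_ultrapower_mem \<iota> U X Y \<longleftrightarrow> sys_limit_mem U (h X) (h Y)) \<and>
             (\<forall>x A. maximal_antichain A \<longrightarrow>
                h (boolean_ultrapower_emb \<iota> U x) = sys_thread U A (sys_emb U A x))"
proof (intro exI conjI ballI allI impI)
  have \<iota>: "inj \<iota>" and U: "ultrafilter U"
    using assms by (simp_all add: embeds_as_set_def)
  show "bij_betw (limit_iso \<iota> U) (boolean_ultrapower \<iota> U) (sys_limit U)"
    using assms(2,1) by (rule limit_iso_bij_betw)
  show "boolean_ultrapower_mem \<iota> U X Y \<longleftrightarrow> sys_limit_mem U (limit_iso \<iota> U X) (limit_iso \<iota> U Y)"
    if "X \<in> boolean_ultrapower \<iota> U" "Y \<in> boolean_ultrapower \<iota> U" for X Y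
    using that unfolding boolean_ultrapower_def
    by (auto simp: boolean_ultrapower_mem_iff[OF U] limit_iso_mem_iff[OF U \<iota>])
  show "limit_iso \<iota> U (boolean_ultrapower_emb \<iota> U x) = sys_thread U A (sys_emb U A x)"
    if A: "maximal_antichain A" for x A
  proof -
    have ground: "bval_ground \<iota> (check \<iota> x) \<in> U"
      using U by (simp add: bval_ground_check ultrafilter_top)
    have "bool_rel (=) (ground_val \<iota> (check \<iota> x)) (step_val A (\<lambda>a\<in>A. x)) \<in> U"
      using bool_rel_eq_refl[OF U ground_val_boolean_element[OF \<iota> ground]]
      by (simp only: ground_val_check[OF \<iota> A])
    then show ?thesis
      unfolding boolean_ultrapower_emb_def sys_emb_def ultrapower_emb_def
      using U \<iota> bname_check ground A by (intro limit_iso_eq_thread) simp_all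
  qed
qed

end
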